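(* Let $p>3$ be prime and $a,b\in\mathbb{Q}_p$ with $ab\ne0$. The equation $x^3+ax=b$ is: (I) solvable in $\mathbb{Z}_p^*$ iff one of: (I.1) $|a|_p<|b|_p=1$ and $\sqrt[3]{b}$ exists; (I.2) $|b|_p<|a|_p=1$ and $\sqrt{-a}$ exists; (I.3) $|a|_p=|b|_p=1$ and $D_0u_{p-2}^2\not\equiv 9a_0^2\pmod p$; (I.4) $|a|_p=|b|_p>1$. (II) solvable in $\mathbb{Z}_p\setminus\mathbb{Z}_p^*$ iff one of: (II.1) $|a|_p^3<|b|_p^2<1$ and $\sqrt[3]{b}$ exists; (II.2) $|a|_p^3=|b|_p^2<1$ and $D_0u_{p-2}^2\not\equiv 9a_0^2\pmod p$; (II.3) $|a|_p^3>|b|_p^2$ and $|a|_p>|b|_p$. (III) solvable in $\mathbb{Q}_p\setminus\mathbb{Z}_p$ iff one of: (III.1) $|a|_p^3<|b|_p^2$, $|b|_p>1$ and $\sqrt[3]{b}$ exists; (III.2) $|a|_p^3=|b|_p^2>1$ and $D_0u_{p-2}^2\not\equiv 9a_0^2\pmod p$; (III.3) $|a|_p^3>|b|_p^2$ and either $|a|_p<|b|_p$, or [$|a|_p\ge|b|_p$, $|a|_p>1$ and $\sqrt{-a}$ exists].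
   Context: "Solvable in $A$" means at least one root in $\mathbb{Q}_p$ lies in $A$. $\mathbb{Z}_p^*=\{|x|_p=1\}$. Nonzero $c\in\mathbb{Q}_p$ is written $c=c^*/|c|_p$, $c^*=c_0+c_1p+\cdots\in\mathbb{Z}_p^*$, $c_0\in\{1,\dots,p-1\}$. "$\sqrt{c}$ exists": $c_0^{(p-1)/2}\equiv1\pmod p$ and $\log_p|c|_p$ even. "$\sqrt[3]{c}$ exists": $c_0^{(p-1)/\gcd(3,p-1)}\equiv1\pmod p$ and $3\mid\log_p|c|_p$. $D_0=-4a_0^3-27b_0^2$; integers $u_n$: $u_1=0,u_2=-a_0,u_3=b_0,u_{n+3}=b_0u_n-a_0u_{n+1}$. *)

theory Defs
  imports Complex_Main "HOL-Number_Theory.Number_Theory"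
begin

text \<open>p-adic integers: coherent sequences of residues, f n = (x mod p^n) in [0, p^n).\<close>
definition Zp :: "nat \<Rightarrow> (nat \<Rightarrow> int) set" where
  "Zp p = {f. \<forall>n. 0 \<le> f n \<and> f n < int p ^ n \<and> f (Suc n) mod int p ^ n = f n}"

definition zzero :: "nat \<Rightarrow> int" where "zzero = (\<lambda>_. 0)"
definition zconst :: "nat \<Rightarrow> int \<Rightarrow> nat \<Rightarrow> int" where
  "zconst p c = (\<lambda>n. c mod int p ^ n)"
definition zadd :: "nat \<Rightarrow> (nat \<Rightarrow> int) \<Rightarrow> (nat \<Rightarrow> int) \<Rightarrow> nat \<Rightarrow> int" where
  "zadd p f g = (\<lambda>n. (f n + g n) mod int p ^ n)"
definition zmul :: "nat \<Rightarrow> (nat \<Rightarrow> int) \<Rightarrow> (nat \<Rightarrow> int) \<Rightarrow> nat \<Rightarrow> int" where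
  "zmul p f g = (\<lambda>n. (f n * g n) mod int p ^ n)"
definition zneg :: "nat \<Rightarrow> (nat \<Rightarrow> int) \<Rightarrow> nat \<Rightarrow> int" where
  "zneg p f = (\<lambda>n. (- f n) mod int p ^ n)"
definition zval :: "(nat \<Rightarrow> int) \<Rightarrow> nat" where
  "zval u = (LEAST n. u (Suc n) \<noteq> 0)"
definition zdivp :: "nat \<Rightarrow> (nat \<Rightarrow> int) \<Rightarrow> nat \<Rightarrow> nat \<Rightarrow> int" where
  "zdivp p u v = (\<lambda>n. u (n + v) div int p ^ v)"

text \<open>p-adic numbers in canonical form: (k, u) stands for p^k * u with u a unit of Z_p;
  zero is (0, zzero).  So |(k,u)|_p = p^(-k) and c* = u, c_0 = u 1.\<close>
definition Qp :: "nat \<Rightarrow> (int \<times> (nat \<Rightarrow> int)) set" where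
  "Qp p = {(k, u). u \<in> Zp p \<and> (u 1 \<noteq> 0 \<or> (k = 0 \<and> u = zzero))}"

definition qzero :: "int \<times> (nat \<Rightarrow> int)" where "qzero = (0, zzero)"

definition qnorm :: "nat \<Rightarrow> int \<Rightarrow> (nat \<Rightarrow> int) \<Rightarrow> int \<times> (nat \<Rightarrow> int)" where
  "qnorm p m s = (if s = zzero then qzero else (m + int (zval s), zdivp p s (zval s)))"

definition qmul :: "nat \<Rightarrow> int \<times> (nat \<Rightarrow> int) \<Rightarrow> int \<times> (nat \<Rightarrow> int) \<Rightarrow> int \<times> (nat \<Rightarrow> int)" where
  "qmul p x y = qnorm p (fst x + fst y) (zmul p (snd x) (snd y))"

definition qadd :: "nat \<Rightarrow> int \<times> (nat \<Rightarrow> int) \<Rightarrow> int \<times> (nat \<Rightarrow> int) \<Rightarrow> int \<times> (nat \<Rightarrow> int)" where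
  "qadd p x y = (let m = min (fst x) (fst y) in
     qnorm p m (zadd p (zmul p (zconst p (int p ^ nat (fst x - m))) (snd x))
                       (zmul p (zconst p (int p ^ nat (fst y - m))) (snd y))))"

definition qneg :: "nat \<Rightarrow> int \<times> (nat \<Rightarrow> int) \<Rightarrow> int \<times> (nat \<Rightarrow> int)" where
  "qneg p x = (fst x, zneg p (snd x))"

definition qabs :: "nat \<Rightarrow> int \<times> (nat \<Rightarrow> int) \<Rightarrow> real" where
  "qabs p x = (if snd x = zzero then 0 else real p powi (- fst x))"

definition digit0 :: "int \<times> (nat \<Rightarrow> int) \<Rightarrow> int" where "digit0 c = snd c 1"
definition logabs :: "int \<times> (nat \<Rightarrow> int) \<Rightarrow> int" where "logabs c = - fst c"

text \<open>The conventions of the paper for existence of square/cube roots.\<close>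
definition sqrt_exists :: "nat \<Rightarrow> int \<times> (nat \<Rightarrow> int) \<Rightarrow> bool" where
  "sqrt_exists p c \<longleftrightarrow> [digit0 c ^ ((p - 1) div 2) = 1] (mod int p) \<and> even (logabs c)"
definition cbrt_exists :: "nat \<Rightarrow> int \<times> (nat \<Rightarrow> int) \<Rightarrow> bool" where
  "cbrt_exists p c \<longleftrightarrow> [digit0 c ^ ((p - 1) div gcd 3 (p - 1)) = 1] (mod int p) \<and> 3 dvd logabs c"

text \<open>The integer sequence u_n (u_0 := 1 is consistent with the recursion and never used).\<close>
fun useq :: "int \<Rightarrow> int \<Rightarrow> nat \<Rightarrow> int" where
  "useq a0 b0 0 = 1"
| "useq a0 b0 (Suc 0) = 0"
| "useq a0 b0 (Suc (Suc 0)) = - a0"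
| "useq a0 b0 (Suc (Suc (Suc 0))) = b0"
| "useq a0 b0 (Suc (Suc (Suc (Suc n)))) = b0 * useq a0 b0 (Suc n) - a0 * useq a0 b0 (Suc (Suc n))"

definition D0 :: "int \<Rightarrow> int \<Rightarrow> int" where "D0 a0 b0 = - 4 * a0 ^ 3 - 27 * b0 ^ 2"

definition disc_cond :: "nat \<Rightarrow> int \<times> (nat \<Rightarrow> int) \<Rightarrow> int \<times> (nat \<Rightarrow> int) \<Rightarrow> bool" where
  "disc_cond p a b \<longleftrightarrow>
     \<not> [D0 (digit0 a) (digit0 b) * (useq (digit0 a) (digit0 b) (p - 2))\<^sup>2 = 9 * (digit0 a)\<^sup>2] (mod int p)"

definition is_root :: "nat \<Rightarrow> int \<times> (nat \<Rightarrow> int) \<Rightarrow> int \<times> (nat \<Rightarrow> int) \<Rightarrow> int \<times> (nat \<Rightarrow> int) \<Rightarrow> bool" where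
  "is_root p a b x \<longleftrightarrow> qadd p (qmul p x (qmul p x x)) (qmul p a x) = b"

definition solvable_in :: "nat \<Rightarrow> int \<times> (nat \<Rightarrow> int) \<Rightarrow> int \<times> (nat \<Rightarrow> int) \<Rightarrow> (int \<times> (nat \<Rightarrow> int)) set \<Rightarrow> bool" where
  "solvable_in p a b A \<longleftrightarrow> (\<exists>x \<in> Qp p. x \<in> A \<and> is_root p a b x)"

definition Zp_num :: "nat \<Rightarrow> (int \<times> (nat \<Rightarrow> int)) set" where
  "Zp_num p = {x \<in> Qp p. qabs p x \<le> 1}"
definition Zp_units :: "nat \<Rightarrow> (int \<times> (nat \<Rightarrow> int)) set" where
  "Zp_units p = {x \<in> Qp p. qabs p x = 1}"

end

theory Submission
  imports Defs "HOL-Computational_Algebra.Polynomial"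
begin

text \<open>
  Write \<open>a = p\<^sup>\<alpha> A\<close>, \<open>b = p\<^sup>\<beta> B\<close>, \<open>x = p\<^sup>k X\<close> with units \<open>A\<close>, \<open>B\<close>, \<open>X\<close>.  The least of the valuations
  \<open>3 k\<close>, \<open>\<alpha> + k\<close>, \<open>\<beta>\<close> must be attained twice; modulo \<open>p\<close> this leaves one of \<open>X\<^sup>3 = B\<close>, \<open>X\<^sup>2 = - A\<close>,
  \<open>A X = B\<close>, \<open>X\<^sup>3 + A X = B\<close>, and in each case a solvable congruence has a simple root, which lifts by
  Hensel's lemma.  For the last congruence put \<open>f = X\<^sup>3 + a X - b\<close>; the integers \<open>u\<^sub>n\<close> are the
  coefficients of the powers of \<open>X\<close> modulo \<open>f\<close>, so that \<open>X\<^sup>p = u\<^bsub>p-2\<^esub> X\<^sup>2 + u\<^bsub>p-1\<^esub> X + b u\<^bsub>p-3\<^esub>\<close>.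
  If \<open>f\<close> has no root modulo \<open>p\<close>, this is a Galois conjugate of \<open>X\<close> different from \<open>X\<close>, which forces
  \<open>D\<^sub>0 u\<^bsub>p-2\<^esub>\<^sup>2 = 9 a\<^sup>2\<close>; conversely that equation makes \<open>D\<^sub>0\<close> a nonzero square, so a single root
  would split \<open>f\<close> completely and give \<open>u\<^bsub>p-2\<^esub> = 0\<close>.
\<close>

section \<open>Cubics modulo p\<close>

lemma prime_dvd_power_diff_int:
  fixes c :: int and p :: nat
  assumes "prime p"
  shows "int p dvd c ^ p - c"
proof (cases "int p dvd c")
  case True
  then have "int p dvd c ^ p" using prime_gt_0_nat[OF assms] by (metis dvd_power dvd_trans)
  then show ?thesis using True by simp
next
  case False
  interpret residues_prime p "residue_ring (int p)"
    by unfold_locales (use assms in auto)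
  have "coprime c (int p)"
    using False assms by (metis coprime_commute prime_imp_coprime prime_nat_int_transfer)
  then have "[c ^ (p - 1) = 1] (mod int p)"
    using euler_theorem[of c] assms by (simp add: totient_prime)
  then have "int p dvd c * (c ^ (p - 1) - 1)"
    by (simp add: cong_iff_dvd_diff)
  also have "c * (c ^ (p - 1) - 1) = c ^ p - c"
    using prime_gt_0_nat[OF assms] by (simp add: algebra_simps power_eq_if[of c p])
  finally show ?thesis .
qed

lemma prime_int_inverse_mod:
  fixes c P :: int
  assumes "prime P" "\<not> P dvd c"
  obtains i where "P dvd c * i - 1"
proof -
  have "coprime c P"
    using assms by (metis coprime_commute prime_imp_coprime)
  then obtain i where "[c * i = 1] (mod P)"
    using cong_solve_coprime_int by blast
  then show ?thesis using that by (simp add: cong_iff_dvd_diff)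
qed

text \<open>The residues prime to p form a cyclic group of order p - 1. Write \<open>c\<close> as a
  power \<open>r ^ i\<close> of a primitive root and let g = gcd n (p - 1). The right-hand
  congruence then says that g divides i, and modulo p - 1 the multiples of g are exactly the
  multiples of n.\<close>

lemma power_residue_criterion:
  fixes p n :: nat and c :: int
  assumes p: "prime p" and n: "n > 0" and c: "\<not> int p dvd c"
  shows "(\<exists>y. [y ^ n = c] (mod int p)) \<longleftrightarrow> [c ^ ((p - 1) div gcd n (p - 1)) = 1] (mod int p)"
proof
  define g where "g = gcd n (p - 1)"
  have p1: "p > 1" using p prime_gt_1_nat by blast
  have g: "g > 0" "g dvd n" "g dvd p - 1" using n by (auto simp: g_def)
  {
    assume "\<exists>y. [y ^ n = c] (mod int p)"
    then obtain y where y: "[y ^ n = c] (mod int p)" by blast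
    have "\<not> int p dvd y"
    proof
      assume "int p dvd y"
      then have "int p dvd y ^ n" using n by (metis dvd_power dvd_trans)
      then show False using y c cong_dvd_iff by blast
    qed
    then have "int p dvd y * (y ^ (p - 1) - 1) \<longrightarrow> int p dvd y ^ (p - 1) - 1"
      using p prime_dvd_mult_iff[of "int p"] by auto
    moreover have "y * (y ^ (p - 1) - 1) = y ^ p - y"
      using p1 by (simp add: algebra_simps power_eq_if[of y p])
    ultimately have y1: "[y ^ (p - 1) = 1] (mod int p)"
      using prime_dvd_power_diff_int[OF p, of y] by (simp add: cong_iff_dvd_diff)
    have "[c ^ ((p - 1) div g) = (y ^ n) ^ ((p - 1) div g)] (mod int p)"
      using y cong_pow cong_sym by blast
    also have "(y ^ n) ^ ((p - 1) div g) = (y ^ (p - 1)) ^ (n div g)"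
      using g by (metis power_mult div_mult_swap mult.commute)
    also have "[\<dots> = 1 ^ (n div g)] (mod int p)"
      using y1 cong_pow by blast
    finally show "[c ^ ((p - 1) div gcd n (p - 1)) = 1] (mod int p)"
      by (simp add: g_def)
  }
  assume A: "[c ^ ((p - 1) div gcd n (p - 1)) = 1] (mod int p)"
  define d where "d = nat (c mod int p)"
  have cd: "[int d = c] (mod int p)" using p1 by (simp add: d_def)
  have dp: "d < p" using p1 by (simp add: d_def nat_less_iff)
  have "d \<noteq> 0" using cd c p1 by (metis cong_0_iff cong_sym of_nat_0)
  then have dtot: "d \<in> totatives p"
    using dp p by (simp add: in_totatives_iff) (metis coprime_commute nat_dvd_not_less neq0_conv prime_imp_coprime)
  obtain r where r: "residue_primroot p r"
    using prime_primitive_root_exists[of p] p p1 by auto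
  then have ordr: "ord p r = p - 1" and copr: "coprime p r"
    using p by (auto simp: residue_primroot_def totient_prime)
  obtain i where i: "d = r ^ i mod p"
    using residue_primroot_is_generator[OF p1 r] dtot unfolding bij_betw_def by blast
  have "[int d ^ ((p - 1) div g) = 1] (mod int p)"
    using A cd unfolding g_def by (meson cong_pow cong_trans)
  then have "[d ^ ((p - 1) div g) = 1] (mod p)"
    by (metis cong_int_iff of_nat_1 of_nat_power)
  moreover have "[d ^ ((p - 1) div g) = (r ^ i) ^ ((p - 1) div g)] (mod p)"
    by (rule cong_pow) (simp add: i)
  ultimately have "[r ^ (i * ((p - 1) div g)) = 1] (mod p)"
    by (metis cong_sym cong_trans power_mult)
  then have "(p - 1) dvd i * ((p - 1) div g)"
    using ordr ord_divides by metis
  then have "g * ((p - 1) div g) dvd i * ((p - 1) div g)"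
    using g by simp
  moreover have "(p - 1) div g \<noteq> 0"
    using g p1 by (metis dvd_div_eq_0_iff zero_less_diff less_numeral_extra(3))
  ultimately have "g dvd i" by simp
  then obtain j where j: "i = g * j" by blast
  \<comment> \<open>By Bezout g is a multiple of n modulo p - 1, hence so is i = g j, and
    \<open>r ^ (s * j)\<close> is an n-th root.\<close>
  obtain s where "[n * s = g] (mod (p - 1))"
    using cong_solve_nat[of n "p - 1"] n unfolding g_def by blast
  then have "[n * s * j = i] (mod (p - 1))"
    unfolding j by (rule cong_scalar_right)
  then have "[r ^ (n * s * j) = r ^ i] (mod p)"
    using order_divides_expdiff[OF copr] ordr by simp
  then have "[(r ^ (s * j)) ^ n = d] (mod p)"
    by (simp add: i power_mult [symmetric] ac_simps)
  then have "[int (r ^ (s * j)) ^ n = int d] (mod int p)"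
    by (metis cong_int_iff of_nat_power)
  then show "\<exists>y. [y ^ n = c] (mod int p)"
    using cd cong_trans by blast
qed

section \<open>The sequence \<open>useq\<close> and powers modulo the cubic\<close>

text \<open>At n = 0 this reads u_3 = b u_0 - a u_1 and rests on the value u_0 = 1. The induction on
  powers of x can therefore start at x^3 itself.\<close>

lemma useq_rec: "useq a b (n + 3) = b * useq a b n - a * useq a b (n + 1)"
  by (cases n) (simp_all add: numeral_3_eq_3)

text \<open>Multiply the remainder by x and replace x^3 by b - a x: the coefficients (u_{n+1},
  u_{n+2}, b u_n) become (u_{n+2}, b u_n - a u_{n+1}, b u_{n+1}), whose middle entry is u_{n+3}. The
  ring is general because x is an integer in one application and the indeterminate of Z[X] in the
  other.\<close>

lemma cubic_dvd_power_minus_useq: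
  fixes x :: "'a :: comm_ring_1"
  shows "(x ^ 3 + of_int a * x - of_int b) dvd
    x ^ (n + 3) - (of_int (useq a b (n + 1)) * x ^ 2 + of_int (useq a b (n + 2)) * x
      + of_int (b * useq a b n))"
proof (induction n)
  case 0
  then show ?case by (simp add: numeral_2_eq_2 numeral_3_eq_3 algebra_simps)
next
  case (Suc n)
  let ?F = "x ^ 3 + of_int a * x - of_int b"
  let ?u = "\<lambda>k. of_int (useq a b k) :: 'a"
  have r: "useq a b (Suc (n + 2)) = b * useq a b n - a * useq a b (n + 1)"
    using useq_rec[of a b n] by (simp add: eval_nat_numeral)
  have "x ^ (Suc n + 3) - (?u (Suc n + 1) * x ^ 2 + ?u (Suc n + 2) * x + of_int (b * useq a b (Suc n)))
      = x * (x ^ (n + 3) - (?u (n + 1) * x ^ 2 + ?u (n + 2) * x + of_int (b * useq a b n)))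
        + ?u (n + 1) * ?F"
    unfolding r add_Suc power_Suc by (simp add: algebra_simps power2_eq_square power3_eq_cube)
  then show ?case using Suc by simp
qed

lemma prime_dvd_freshman:
  fixes x y :: "'a :: comm_ring_1" and p :: nat
  assumes "prime p"
  shows "of_nat p dvd (x + y) ^ p - x ^ p - y ^ p"
proof -
  have p1: "p > 1" using assms prime_gt_1_nat by blast
  have "(x + y) ^ p = (\<Sum>k\<le>p. of_nat (p choose k) * x ^ k * y ^ (p - k))"
    by (rule binomial_ring)
  also have "{..p} = insert 0 (insert p {0<..<p})" using p1 by auto
  also have "(\<Sum>k\<in>insert 0 (insert p {0<..<p}). of_nat (p choose k) * x ^ k * y ^ (p - k))
    = y ^ p + (x ^ p + (\<Sum>k\<in>{0<..<p}. of_nat (p choose k) * x ^ k * y ^ (p - k)))"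
    using p1 by simp
  finally have "(x + y) ^ p - x ^ p - y ^ p = (\<Sum>k\<in>{0<..<p}. of_nat (p choose k) * x ^ k * y ^ (p - k))"
    by simp
  moreover have "of_nat p dvd (\<Sum>k\<in>{0<..<p}. of_nat (p choose k) * x ^ k * y ^ (p - k))"
  proof (rule dvd_sum)
    fix k assume "k \<in> {0<..<p}"
    then have "p dvd p choose k" using assms by (intro dvd_choose_prime) auto
    then have "of_nat p dvd (of_nat (p choose k) :: 'a)" by (metis dvd_def of_nat_mult)
    then show "of_nat p dvd of_nat (p choose k) * x ^ k * y ^ (p - k)" by simp
  qed
  ultimately show ?thesis by simp
qed

text \<open>Let f = X^3 + a X - b and suppose that the congruence holds. Modulo p, D_0 is f'(r)^2
  times the discriminant of f / (X - r). This discriminant is then a nonzero square, so f has three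
  distinct roots. By Fermat they are all zeros of u y^2 + (v - 1) y + w, which forces u = 0 and
  contradicts 9 a^2 being nonzero.\<close>

lemma useq_disc_if_root:
  fixes p :: nat and a b r :: int
  assumes p: "prime p" "p > 3" and a: "\<not> int p dvd a"
    and r: "int p dvd r ^ 3 + a * r - b"
  shows "\<not> int p dvd D0 a b * (useq a b (p - 2))\<^sup>2 - 9 * a\<^sup>2"
proof
  define P where "P = int p"
  define u v w where "u = useq a b (p - 2)" and "v = useq a b (p - 1)" and "w = b * useq a b (p - 3)"
  assume "int p dvd D0 a b * (useq a b (p - 2))\<^sup>2 - 9 * a\<^sup>2"
  then have D: "P dvd D0 a b * u\<^sup>2 - 9 * a\<^sup>2" by (simp add: P_def u_def)
  have P: "prime P" "P > 3" using p by (auto simp: P_def)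
  have P3: "\<not> P dvd 3" "\<not> P dvd 2" using P by (auto dest!: zdvd_imp_le)
  have pm: "P dvd x * y \<longleftrightarrow> P dvd x \<or> P dvd y" for x y
    using P(1) by (rule prime_dvd_mult_iff)
  \<comment> \<open>For a root y of the cubic, y^p is congruent both to y and to its reduction by
    the cubic.\<close>
  have fp: "P dvd u * y ^ 2 + (v - 1) * y + w" if y: "P dvd y ^ 3 + a * y - b" for y
  proof -
    have "P dvd y ^ p - (u * y ^ 2 + v * y + w)"
      using dvd_trans[OF y, of "y ^ p - (u * y ^ 2 + v * y + w)"]
        cubic_dvd_power_minus_useq[of y a b "p - 3"] p
      by (simp add: u_def v_def w_def Suc_diff_Suc numeral_3_eq_3 numeral_2_eq_2)
    moreover have "P dvd y ^ p - y"
      unfolding P_def by (rule prime_dvd_power_diff_int[OF p(1)])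
    ultimately have "P dvd (y ^ p - y) - (y ^ p - (u * y ^ 2 + v * y + w))"
      by (rule dvd_diff[rotated])
    then show ?thesis by (simp add: algebra_simps)
  qed
  \<comment> \<open>\<open>f'\<close> is the derivative at r, and \<open>\<Delta>\<close> is the
    discriminant of the cofactor X^2 + r X + r^2 + a of X - r.\<close>
  define f' where "f' = 3 * r ^ 2 + a"
  define \<Delta> where "\<Delta> = - 3 * r ^ 2 - 4 * a"
  have "D0 a b - f' ^ 2 * \<Delta> = 27 * (r ^ 3 + a * r - b) * (r ^ 3 + a * r + b)"
    unfolding D0_def f'_def \<Delta>_def by (simp add: algebra_simps power2_eq_square power3_eq_cube)
  then have "P dvd D0 a b - f' ^ 2 * \<Delta>" using r by (metis P_def dvd_mult dvd_mult2)
  then have "P dvd (D0 a b * u\<^sup>2 - 9 * a\<^sup>2) - (D0 a b - f' ^ 2 * \<Delta>) * u ^ 2"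
    by (intro dvd_diff[OF D] dvd_mult2)
  also have "(D0 a b * u\<^sup>2 - 9 * a\<^sup>2) - (D0 a b - f' ^ 2 * \<Delta>) * u ^ 2 = (f' * u) ^ 2 * \<Delta> - (3 * a) ^ 2"
    by (simp add: algebra_simps power2_eq_square)
  finally have sq: "P dvd (f' * u) ^ 2 * \<Delta> - (3 * a) ^ 2" .
  have na: "\<not> P dvd (3 * a) ^ 2" using a P3 pm prime_dvd_power[OF P(1)] by (metis P_def)
  have nf: "\<not> P dvd f' * u"
  proof
    assume "P dvd f' * u"
    then have "P dvd (f' * u) ^ 2 * \<Delta>" by (simp add: power2_eq_square)
    then show False using sq na by (metis dvd_diff_right_iff)
  qed
  then have nu: "\<not> P dvd u" and nf': "\<not> P dvd f'" by auto
  obtain i where i: "P dvd (f' * u) * i - 1" using prime_int_inverse_mod[OF P(1) nf] .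
  obtain h where h: "P dvd 2 * h - 1" using prime_int_inverse_mod[OF P(1) P3(2)] .
  \<comment> \<open>Since \<open>i\<close> inverts \<open>f' * u\<close>, this is 3 a / (f' u), a
    square root of \<open>\<Delta>\<close> modulo P.\<close>
  define \<delta> where "\<delta> = 3 * a * i"
  have "P dvd ((f' * u) ^ 2 * \<Delta> - (3 * a) ^ 2) * i ^ 2 - ((f' * u) * i - 1) * (f' * u * i + 1) * \<Delta>"
    using sq i by (intro dvd_diff) auto
  also have "((f' * u) ^ 2 * \<Delta> - (3 * a) ^ 2) * i ^ 2 - ((f' * u) * i - 1) * (f' * u * i + 1) * \<Delta>
     = \<Delta> - \<delta> ^ 2" unfolding \<delta>_def by (simp add: algebra_simps power2_eq_square power3_eq_cube)
  finally have \<delta>: "P dvd \<Delta> - \<delta> ^ 2" .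
  have n\<delta>: "\<not> P dvd \<delta>"
  proof
    assume "P dvd \<delta>"
    then have "P dvd \<Delta>" using \<delta> by (metis dvd_diff_right_iff power2_eq_square dvd_mult dvd_diff_left_iff)
    then have "P dvd (f' * u) ^ 2 * \<Delta>" by simp
    then show False using sq na by (metis dvd_diff_right_iff)
  qed
  \<comment> \<open>Quadratic formula: the roots of the cofactor are (- r + e) / 2 for the two
    square roots e of \<open>\<Delta>\<close>. The factor 8 clears the halves.\<close>
  have root: "P dvd y ^ 3 + a * y - b" if "P dvd 2 * y + r - e" "e = \<delta> \<or> e = - \<delta>" for y e
  proof -
    have e2: "e ^ 2 = \<delta> ^ 2" using that(2) by auto
    have "8 * (y ^ 3 + a * y - b) = (2 * y + r - e) * (4 * y ^ 2 + 2 * y * (e - r) + (e - r) ^ 2 + 4 * a)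
      + (e - 3 * r) * (e ^ 2 - \<Delta>) + 8 * (r ^ 3 + a * r - b)"
      unfolding \<Delta>_def by (simp add: algebra_simps power2_eq_square power3_eq_cube)
    moreover have "P dvd e ^ 2 - \<Delta>" using \<delta> unfolding e2 by (metis dvd_diff_commute)
    ultimately have "P dvd 8 * (y ^ 3 + a * y - b)" using that(1) r by (metis P_def dvd_add dvd_mult dvd_mult2)
    moreover have "\<not> P dvd 8" using P3(2) pm[of 2 4] pm[of 2 2] by auto
    ultimately show ?thesis using pm by blast
  qed
  define s t where "s = h * (\<delta> - r)" and "t = h * (- \<delta> - r)"
  have hs: "2 * s + r - \<delta> = (2 * h - 1) * (\<delta> - r)" "2 * t + r - (- \<delta>) = (2 * h - 1) * (- \<delta> - r)"
    unfolding s_def t_def by (simp_all add: algebra_simps power2_eq_square power3_eq_cube)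
  have s2: "P dvd 2 * s + r - \<delta>" and t2: "P dvd 2 * t + r - (- \<delta>)"
    unfolding hs using h by auto
  have fs: "P dvd s ^ 3 + a * s - b" and ft: "P dvd t ^ 3 + a * t - b"
    using root[OF s2] root[OF t2] by auto
  have rr: "P dvd r ^ 3 + a * r - b" using r by (simp add: P_def)
  \<comment> \<open>If y = r then e = 3 r, and e^2 = \<open>\<Delta>\<close> turns into 4 f'(r) = 0
    modulo P.\<close>
  have ne: "\<not> P dvd y - r" if "P dvd 2 * y + r - e" "e = \<delta> \<or> e = - \<delta>" for y e
  proof
    assume y: "P dvd y - r"
    have e2: "e ^ 2 = \<delta> ^ 2" using that(2) by auto
    have "4 * f' = (2 * (y - r) - (2 * y + r - e)) * (- 3 * r - e) + (\<delta> ^ 2 - \<Delta>)"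
      unfolding f'_def \<Delta>_def e2[symmetric] by (simp add: algebra_simps power2_eq_square power3_eq_cube)
    moreover have "P dvd \<delta> ^ 2 - \<Delta>" using \<delta> by (metis dvd_diff_commute)
    moreover have "P dvd 2 * (y - r) - (2 * y + r - e)" by (intro dvd_diff[OF dvd_mult[OF y] that(1)])
    ultimately have "P dvd 4 * f'" by (metis dvd_add dvd_mult2)
    then show False using nf' pm[of 4 f'] pm[of 2 2] P3 by auto
  qed
  \<comment> \<open>Subtract the values of the quadratic at y and r, then cancel the factor y -
    r.\<close>
  have lin: "P dvd u * (y + r) + (v - 1)" if "P dvd y ^ 3 + a * y - b" "\<not> P dvd y - r" for y
  proof -
    have "P dvd (u * y ^ 2 + (v - 1) * y + w) - (u * r ^ 2 + (v - 1) * r + w)"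
      using fp[OF that(1)] fp[OF rr] by (rule dvd_diff)
    also have "\<dots> = (y - r) * (u * (y + r) + (v - 1))" by (simp add: algebra_simps power2_eq_square power3_eq_cube)
    finally show ?thesis using that(2) pm by blast
  qed
  have "P dvd (u * (s + r) + (v - 1)) - (u * (t + r) + (v - 1))"
    using lin[OF fs ne[OF s2]] lin[OF ft ne[OF t2]] by (intro dvd_diff) auto
  also have "\<dots> = u * (s - t)" by (simp add: algebra_simps power2_eq_square power3_eq_cube)
  finally have "P dvd s - t" using nu pm by blast
  \<comment> \<open>Modulo P the numbers 2 s and 2 t differ by 2 \<open>\<delta>\<close>, so s = t
    would make \<open>\<delta>\<close> vanish.\<close>
  then have "P dvd (2 * s + r - \<delta>) - (2 * t + r - (- \<delta>)) - 2 * (s - t)"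
    by (intro dvd_diff[OF dvd_diff[OF s2 t2]] dvd_mult)
  also have "\<dots> = (- 2) * \<delta>" by (simp add: algebra_simps power2_eq_square power3_eq_cube)
  finally show False using n\<delta> pm P3 by (metis dvd_minus_iff)
qed

section \<open>Polynomials modulo a prime and modulo the cubic\<close>

text \<open>Lagrange's bound on the number of roots over a prime field, phrased inside Z[X].
  Splitting off X - c lowers the degree, and the other points of S remain zeros of the quotient
  modulo P because P does not divide s - c.\<close>

lemma prime_dvd_poly_if_many_roots:
  fixes P :: int and K :: "int poly"
  assumes P: "prime P" and "finite S"
    and "\<And>s t. s \<in> S \<Longrightarrow> t \<in> S \<Longrightarrow> P dvd s - t \<Longrightarrow> s = t"
    and "\<And>s. s \<in> S \<Longrightarrow> P dvd poly K s"
    and "degree K < card S"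
  shows "[:P:] dvd K"
  using assms(2-)
proof (induction "card S" arbitrary: S K)
  case 0
  then show ?case by simp
next
  case (Suc n)
  then obtain c where c: "c \<in> S" by fastforce
  define Q where "Q = synthetic_div K c"
  have K: "K = [:- c, 1:] * Q + [:poly K c:]"
    using synthetic_div_correct'[of c K] by (simp add: Q_def)
  have "[:P:] dvd Q"
  proof (cases "degree K = 0")
    case True
    then have "Q = 0" by (simp add: Q_def synthetic_div_eq_0_iff)
    then show ?thesis by simp
  next
    case False
    show ?thesis
    proof (rule Suc.hyps(1)[of "S - {c}"])
      show "n = card (S - {c})" using Suc.hyps(2) c Suc.prems(1) by simp
      show "finite (S - {c})" using Suc.prems(1) by simp
      show "degree Q < card (S - {c})"
        using False Suc.prems(4) Suc.prems(1) c by (simp add: Q_def degree_synthetic_div)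
      show "s = t" if "s \<in> S - {c}" "t \<in> S - {c}" "P dvd s - t" for s t
        using that Suc.prems(2) by auto
      show "P dvd poly Q s" if s: "s \<in> S - {c}" for s
      proof -
        have "poly K s = (s - c) * poly Q s + poly K c"
          by (subst K) (simp add: algebra_simps)
        moreover have "P dvd poly K s" "P dvd poly K c" using Suc.prems(3) s c by auto
        ultimately have "P dvd (s - c) * poly Q s" by (metis dvd_add_left_iff)
        moreover have "\<not> P dvd s - c" using Suc.prems(2) s c by auto
        ultimately show ?thesis using P prime_dvd_mult_iff by blast
      qed
    qed
  qed
  moreover have "[:P:] dvd [:poly K c:]" using Suc.prems(3)[OF c] by simp
  ultimately show ?case by (metis K dvd_add dvd_mult)
qed

text \<open>The ideal (P, f) of Z[X] with f = X^3 + a X - b. Membership means vanishing in Z[X] /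
  (P, f), a field if P is prime and f has no root modulo P. Calculations in that field thus become
  statements about integer polynomials.\<close>

definition in_cubic_ideal :: "int \<Rightarrow> int \<Rightarrow> int \<Rightarrow> int poly \<Rightarrow> bool" where
  "in_cubic_ideal P a b h \<longleftrightarrow> (\<exists>Q R. h = [:- b, a, 0, 1:] * Q + [:P:] * R)"

lemma in_cubic_ideal_add:
  "in_cubic_ideal P a b g \<Longrightarrow> in_cubic_ideal P a b h \<Longrightarrow> in_cubic_ideal P a b (g + h)"
proof -
  assume "in_cubic_ideal P a b g" "in_cubic_ideal P a b h"
  then obtain Q R Q' R' where "g = [:- b, a, 0, 1:] * Q + [:P:] * R" "h = [:- b, a, 0, 1:] * Q' + [:P:] * R'"
    unfolding in_cubic_ideal_def by blast
  then have "g + h = [:- b, a, 0, 1:] * (Q + Q') + [:P:] * (R + R')"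
    by (simp add: distrib_left)
  then show ?thesis unfolding in_cubic_ideal_def by blast
qed

lemma in_cubic_ideal_mult: "in_cubic_ideal P a b h \<Longrightarrow> in_cubic_ideal P a b (g * h)"
proof -
  assume "in_cubic_ideal P a b h"
  then obtain Q R where "h = [:- b, a, 0, 1:] * Q + [:P:] * R"
    unfolding in_cubic_ideal_def by blast
  then have "g * h = [:- b, a, 0, 1:] * (g * Q) + [:P:] * (g * R)"
    by (simp only: distrib_left mult.left_commute)
  then show ?thesis unfolding in_cubic_ideal_def by blast
qed

lemma in_cubic_ideal_diff:
  "in_cubic_ideal P a b g \<Longrightarrow> in_cubic_ideal P a b h \<Longrightarrow> in_cubic_ideal P a b (g - h)"
  using in_cubic_ideal_add[of P a b g "(- 1) * h"] in_cubic_ideal_mult[of P a b h "- 1"] by simp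

lemma in_cubic_ideal_cubic: "in_cubic_ideal P a b [:- b, a, 0, 1:]"
  unfolding in_cubic_ideal_def by (rule exI[of _ 1], rule exI[of _ 0]) simp

lemma in_cubic_ideal_const: "[:P:] dvd h \<Longrightarrow> in_cubic_ideal P a b h"
  unfolding in_cubic_ideal_def by (metis add_0 dvdE mult_zero_right)

lemma cubic_division:
  fixes R :: "int poly"
  shows "\<exists>S t0 t1 t2. R = [:- b, a, 0, 1:] * S + [:t0, t1, t2:]"
proof (induction R)
  case 0
  show ?case by (intro exI[of _ 0]) simp
next
  case (pCons r R)
  then obtain S t0 t1 t2 where R: "R = [:- b, a, 0, 1:] * S + [:t0, t1, t2:]" by blast
  have "pCons r R = [:r:] + [:0, 1:] * R" by simp
  also have "\<dots> = [:- b, a, 0, 1:] * ([:0, 1:] * S + [:t2:]) + [:r + b * t2, t0 - a * t2, t1:]"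
    unfolding R by (simp add: algebra_simps)
  finally show ?case by blast
qed

text \<open>Once R is reduced modulo the cubic, the given polynomial minus P times a polynomial of
  degree at most 2 is a multiple of the cubic. That multiple has degree at most 2 while the cubic is
  monic of degree 3, so it is zero.\<close>

lemma in_cubic_ideal_remainder:
  assumes "in_cubic_ideal P a b [:c0, c1, c2:]"
  shows "P dvd c0" "P dvd c1" "P dvd c2"
proof -
  obtain Q R where QR: "[:c0, c1, c2:] = [:- b, a, 0, 1:] * Q + [:P:] * R"
    using assms unfolding in_cubic_ideal_def by blast
  obtain S t0 t1 t2 where R: "R = [:- b, a, 0, 1:] * S + [:t0, t1, t2:]"
    using cubic_division by blast
  have "[:c0 - P * t0, c1 - P * t1, c2 - P * t2:] = [:c0, c1, c2:] - [:P:] * [:t0, t1, t2:]"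
    by simp
  also have "\<dots> = [:- b, a, 0, 1:] * (Q + [:P:] * S)"
    unfolding QR R by (simp only: algebra_simps)
  finally have eq: "[:c0 - P * t0, c1 - P * t1, c2 - P * t2:] = [:- b, a, 0, 1:] * (Q + [:P:] * S)" .
  have "Q + [:P:] * S = 0"
  proof (rule ccontr)
    assume nz: "Q + [:P:] * S \<noteq> 0"
    have "degree ([:- b, a, 0, 1:] * (Q + [:P:] * S)) = 3 + degree (Q + [:P:] * S)"
      using nz by (subst degree_mult_eq) auto
    moreover have "degree [:c0 - P * t0, c1 - P * t1, c2 - P * t2:] \<le> 2"
      by (simp add: degree_pCons_le)
    ultimately show False unfolding eq by simp
  qed
  then have "[:c0 - P * t0, c1 - P * t1, c2 - P * t2:] = 0" using eq by simp
  then show "P dvd c0" "P dvd c1" "P dvd c2" by auto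
qed

lemma in_cubic_ideal_cancel_const:
  assumes "prime P" "\<not> P dvd c" "in_cubic_ideal P a b ([:c:] * h)"
  shows "in_cubic_ideal P a b h"
proof -
  obtain i where i: "P dvd c * i - 1" using prime_int_inverse_mod[OF assms(1,2)] .
  have "h = [:i:] * ([:c:] * h) - [:c * i - 1:] * h"
    by (simp add: algebra_simps smult_diff_left)
  moreover have "in_cubic_ideal P a b ([:c * i - 1:] * h)"
    using i by (intro in_cubic_ideal_const dvd_mult2) simp
  ultimately show ?thesis
    using in_cubic_ideal_diff in_cubic_ideal_mult[OF assms(3)] by metis
qed

text \<open>If the factor is not constant modulo P, it may be normalised to X - r. Since f(r) = f -
  (X^2 + r X + r^2 + a) (X - r), the product f(r) h lies in the ideal, and the constant f(r) is
  invertible modulo P.\<close>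

lemma in_cubic_ideal_cancel_linear:
  assumes P: "prime P" and nr: "\<And>y. \<not> P dvd y ^ 3 + a * y - b"
    and nz: "\<not> (P dvd c0 \<and> P dvd c1)" and h: "in_cubic_ideal P a b ([:c0, c1:] * h)"
  shows "in_cubic_ideal P a b h"
proof (cases "P dvd c1")
  case True
  have "[:c0:] * h = [:c0, c1:] * h - [:c1:] * ([:0, 1:] * h)"
    by (simp add: algebra_simps)
  moreover have "in_cubic_ideal P a b ([:c1:] * ([:0, 1:] * h))"
    using True by (intro in_cubic_ideal_const dvd_mult2) simp
  ultimately have "in_cubic_ideal P a b ([:c0:] * h)"
    using h in_cubic_ideal_diff by metis
  then show ?thesis using nz True P in_cubic_ideal_cancel_const by blast
next
  case False
  obtain i where i: "P dvd c1 * i - 1" using prime_int_inverse_mod[OF P False] .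
  define r where "r = - (c0 * i)"
  have "[:- r, 1:] * h = [:i:] * ([:c0, c1:] * h) - [:c1 * i - 1:] * ([:0, 1:] * h)"
    unfolding r_def by (simp add: algebra_simps smult_diff_left)
  moreover have "in_cubic_ideal P a b ([:c1 * i - 1:] * ([:0, 1:] * h))"
    using i by (intro in_cubic_ideal_const dvd_mult2) simp
  ultimately have 1: "in_cubic_ideal P a b ([:- r, 1:] * h)"
    using in_cubic_ideal_mult[OF h] in_cubic_ideal_diff by metis
  have "[:r ^ 3 + a * r - b:] = [:- b, a, 0, 1:] - [:r ^ 2 + a, r, 1:] * [:- r, 1:]"
    by (simp add: algebra_simps power2_eq_square power3_eq_cube)
  then have "[:r ^ 3 + a * r - b:] * h
      = h * [:- b, a, 0, 1:] - [:r ^ 2 + a, r, 1:] * ([:- r, 1:] * h)"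
    by (simp only: left_diff_distrib mult.assoc mult.commute[of h])
  then have "in_cubic_ideal P a b ([:r ^ 3 + a * r - b:] * h)"
    using in_cubic_ideal_mult[OF 1] in_cubic_ideal_mult[OF in_cubic_ideal_cubic] in_cubic_ideal_diff
    by metis
  then show ?thesis using nr P in_cubic_ideal_cancel_const by blast
qed

text \<open>One step of Euclid's algorithm: for q = X^2 + s X + t the polynomial (X - s) q - f has
  degree at most 1. It does not vanish modulo P, since otherwise f = (X - s) q would have the root
  s. This reduces the claim to a linear factor.\<close>

lemma in_cubic_ideal_cancel:
  assumes P: "prime P" and nr: "\<And>y. \<not> P dvd y ^ 3 + a * y - b"
    and nz: "\<not> (P dvd c0 \<and> P dvd c1 \<and> P dvd c2)"
    and h: "in_cubic_ideal P a b ([:c0, c1, c2:] * h)"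
  shows "in_cubic_ideal P a b h"
proof (cases "P dvd c2")
  case True
  have "[:c0, c1:] * h = [:c0, c1, c2:] * h - [:c2:] * ([:0, 0, 1:] * h)"
    by (simp add: algebra_simps)
  moreover have "in_cubic_ideal P a b ([:c2:] * ([:0, 0, 1:] * h))"
    using True by (intro in_cubic_ideal_const dvd_mult2) simp
  ultimately have "in_cubic_ideal P a b ([:c0, c1:] * h)"
    using h in_cubic_ideal_diff by metis
  then show ?thesis using in_cubic_ideal_cancel_linear[OF P nr] nz True by blast
next
  case False
  obtain i where i: "P dvd c2 * i - 1" using prime_int_inverse_mod[OF P False] .
  define t s where "t = c0 * i" and "s = c1 * i"
  have "[:t, s, 1:] * h = [:i:] * ([:c0, c1, c2:] * h) - [:c2 * i - 1:] * ([:0, 0, 1:] * h)"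
    unfolding t_def s_def by (simp add: algebra_simps smult_diff_left)
  moreover have "in_cubic_ideal P a b ([:c2 * i - 1:] * ([:0, 0, 1:] * h))"
    using i by (intro in_cubic_ideal_const dvd_mult2) simp
  ultimately have 1: "in_cubic_ideal P a b ([:t, s, 1:] * h)"
    using in_cubic_ideal_mult[OF h] in_cubic_ideal_diff by metis
  have "[:b - s * t, t - s ^ 2 - a:] = [:- s, 1:] * [:t, s, 1:] - [:- b, a, 0, 1:]"
    by (simp add: algebra_simps power2_eq_square)
  then have "[:b - s * t, t - s ^ 2 - a:] * h = [:- s, 1:] * ([:t, s, 1:] * h) - h * [:- b, a, 0, 1:]"
    by (simp only: left_diff_distrib mult.assoc mult.commute[of h])
  then have 2: "in_cubic_ideal P a b ([:b - s * t, t - s ^ 2 - a:] * h)"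
    using in_cubic_ideal_mult[OF 1] in_cubic_ideal_mult[OF in_cubic_ideal_cubic] in_cubic_ideal_diff
    by metis
  have "\<not> (P dvd b - s * t \<and> P dvd t - s ^ 2 - a)"
  proof
    assume "P dvd b - s * t \<and> P dvd t - s ^ 2 - a"
    then have "P dvd - (b - s * t) - s * (t - s ^ 2 - a)" by (metis dvd_diff dvd_minus_iff dvd_mult)
    also have "- (b - s * t) - s * (t - s ^ 2 - a) = s ^ 3 + a * s - b" by (simp add: algebra_simps power2_eq_square power3_eq_cube)
    finally show False using nr by blast
  qed
  then show ?thesis using in_cubic_ideal_cancel_linear[OF P nr _ 2] by blast
qed

text \<open>In the field \<open>\<int>[X] / (p, f)\<close> the element \<open>\<phi> = u X\<^sup>2 + v X + w\<close> is a root of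
  \<open>f(Y) / (Y - X) = Y\<^sup>2 + X Y + X\<^sup>2 + a\<close>; the hypotheses are the three coefficients of this equation.
  Put \<open>e = 3 w - 2 a u\<close> (the trace of \<open>\<phi>\<close>) and \<open>m = 2 v + 1\<close>.  Elimination gives \<open>e (1 + u e) = 0\<close>,
  and \<open>u e = - 1\<close> is impossible because then \<open>- m / u\<close> is a root of \<open>f\<close>.\<close>

lemma disc_if_no_root_aux:
  fixes P a b u v w :: int
  assumes P: "prime P" "P > 3" and a: "\<not> P dvd a"
    and nr: "\<And>y. \<not> P dvd y ^ 3 + a * y - b"
    and E2: "P dvd - a * u ^ 2 + v ^ 2 + 2 * u * w + v + 1"
    and E1: "P dvd b * u ^ 2 - 2 * a * u * v + 2 * v * w + w - a * u"
    and E0: "P dvd 2 * b * u * v + w ^ 2 + b * u + a"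
  shows "P dvd D0 a b * u\<^sup>2 - 9 * a\<^sup>2"
proof -
  have P3: "\<not> P dvd 3" "\<not> P dvd 2" using P by (auto dest!: zdvd_imp_le)
  have pm: "P dvd x * y \<longleftrightarrow> P dvd x \<or> P dvd y" for x y
    using P(1) by (rule prime_dvd_mult_iff)
  define e m where "e = 3 * w - 2 * a * u" and "m = 2 * v + 1"
  define F0 F1 F2 where "F0 = 2 * b * u * v + w ^ 2 + b * u + a"
    and "F1 = b * u ^ 2 - 2 * a * u * v + 2 * v * w + w - a * u"
    and "F2 = - a * u ^ 2 + v ^ 2 + 2 * u * w + v + 1"
  note F = F0_def F1_def F2_def
  have E: "P dvd F0" "P dvd F1" "P dvd F2" using E0 E1 E2 by (simp_all add: F)
  \<comment> \<open>With u = 0 the relation \<open>F1\<close> becomes w m = 0; then w = 0 leaves a =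
    0 in \<open>F0\<close>, and m = 0 leaves 3 = 0 in \<open>4 * F2\<close>.\<close>
  have nu: "\<not> P dvd u"
  proof
    assume u: "P dvd u"
    have "P dvd F1 - u * (b * u - 2 * a * v - a)" using E u by (intro dvd_diff) auto
    also have "\<dots> = w * m" unfolding F m_def by (simp add: algebra_simps power2_eq_square power3_eq_cube)
    finally have "P dvd w \<or> P dvd m" using pm by blast
    moreover have "\<not> P dvd w"
    proof
      assume "P dvd w"
      then have "P dvd F0 - u * (2 * b * v + b) - w * w" using E u by (intro dvd_diff) auto
      also have "\<dots> = a" unfolding F by (simp add: algebra_simps power2_eq_square power3_eq_cube)
      finally show False using a by blast
    qed
    moreover have "\<not> P dvd m"
    proof
      assume "P dvd m"
      then have "P dvd 4 * F2 - u * (8 * w - 4 * a * u) - m * m" using E u by (intro dvd_diff) auto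
      also have "\<dots> = 3" unfolding F m_def by (simp add: algebra_simps power2_eq_square power3_eq_cube)
      finally show False using P3 by blast
    qed
    ultimately show False by blast
  qed
  have "P dvd u * F0 - m * F1 - 4 * (a * u - w) * F2" using E by (intro dvd_diff) auto
  also have "\<dots> = e * (1 + u * e)" unfolding F e_def m_def by (simp add: algebra_simps power2_eq_square power3_eq_cube)
  finally consider "P dvd e" | "P dvd 1 + u * e" using pm by blast
  then show ?thesis
  proof cases
    case 1
    have "P dvd 3 * F1 - e * m" using E 1 by (intro dvd_diff) auto
    also have "\<dots> = u * (3 * b * u - a * m)" unfolding F e_def m_def by (simp add: algebra_simps power2_eq_square power3_eq_cube)
    finally have d1: "P dvd 3 * b * u - a * m" using nu pm by blast
    \<comment> \<open>This relation is 3 m^2 + 9 + 4 a u^2 = 0 modulo P. Eliminating m by means of a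
      m = 3 b u from \<open>d1\<close> gives the claim.\<close>
    have d2: "P dvd 12 * F2 - 8 * u * e" using E 1 by (intro dvd_diff) auto
    have "P dvd - (a ^ 2 * (12 * F2 - 8 * u * e)) - (3 * b * u - a * m) * (3 * (3 * b * u + a * m))"
      using d1 d2 by (intro dvd_diff) (auto simp: dvd_minus_iff)
    also have "\<dots> = D0 a b * u\<^sup>2 - 9 * a\<^sup>2"
      unfolding F e_def m_def D0_def by (simp add: algebra_simps power2_eq_square power3_eq_cube)
    finally show ?thesis .
  next
    case 2
    obtain i where i: "P dvd u * i - 1" using prime_int_inverse_mod[OF P(1) nu] .
    \<comment> \<open>With u e = - 1 the relations below become 3 b u^3 = m (a u^2 + 1) and 3 m^2 +
      4 a u^2 + 1 = 0 modulo P. Together they say that - m / u is a root of the cubic.\<close>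
    define y where "y = - (m * i)"
    have uy: "P dvd u * y + m"
    proof -
      have "u * y + m = - m * (u * i - 1)" unfolding y_def by (simp add: algebra_simps power2_eq_square power3_eq_cube)
      then show ?thesis using i by simp
    qed
    have d1: "P dvd 3 * u * F1 - (1 + u * e) * m" using E 2 by (intro dvd_diff) auto
    have d2: "P dvd 12 * F2 - 8 * (1 + u * e)" using E 2 by (intro dvd_diff dvd_mult)
    have "12 * u ^ 3 * (y ^ 3 + a * y - b)
      = (u * y + m) * (12 * ((u * y) ^ 2 - u * y * m + m ^ 2) + 12 * a * u ^ 2)
        - (4 * (3 * u * F1 - (1 + u * e) * m) + 4 * m * (12 * F2 - 8 * (1 + u * e)))"
      unfolding F e_def m_def by (simp add: algebra_simps power2_eq_square power3_eq_cube)
    also have "P dvd \<dots>"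
      by (intro dvd_diff dvd_add dvd_mult2[OF uy] dvd_mult[OF d1] dvd_mult[OF d2])
    finally have "P dvd 12 * u ^ 3 * (y ^ 3 + a * y - b)" .
    moreover have "\<not> P dvd 12" using pm[of 4 3] pm[of 2 2] P3 by auto
    moreover have "\<not> P dvd u ^ 3" using nu P(1) prime_dvd_power by blast
    ultimately show ?thesis using nr pm by blast
  qed
qed

lemma depressed_cubic_diff:
  fixes x y c d :: "'a :: comm_ring_1"
  shows "(x - y) * (x\<^sup>2 + x * y + y\<^sup>2 + c) = (x ^ 3 + c * x - d) - (y ^ 3 + c * y - d)"
  by (simp add: algebra_simps power2_eq_square power3_eq_cube)

text \<open>Modulo P the Frobenius map respects sums and fixes integer coefficients, so f(X^p) =
  f(X)^p = 0 in Z[X] / (P, f). Hence the reduction \<open>\<phi>\<close> of X^p is a root of f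
  there. Cancelling \<open>\<phi>\<close> - X from f(\<open>\<phi>\<close>) - f(X) leaves a
  quadratic relation, whose three coefficients are the hypotheses of
  \<open>disc_if_no_root_aux\<close>.\<close>

lemma disc_if_no_root:
  fixes p :: nat and a b :: int
  assumes p: "prime p" "p > 3" and a: "\<not> int p dvd a"
    and nr: "\<And>y. \<not> int p dvd y ^ 3 + a * y - b"
  shows "int p dvd D0 a b * (useq a b (p - 2))\<^sup>2 - 9 * a\<^sup>2"
proof -
  define P where "P = int p"
  define u v w where "u = useq a b (p - 2)" and "v = useq a b (p - 1)" and "w = b * useq a b (p - 3)"
  have P: "prime P" "P > 3" using p by (auto simp: P_def)
  have nr': "\<And>y. \<not> P dvd y ^ 3 + a * y - b" using nr by (simp add: P_def)
  define X where "X = [:0, 1::int:]"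
  define f where "f = [:- b, a, 0, 1:]"
  define \<phi> where "\<phi> = [:w, v, u:]"
  let ?I = "in_cubic_ideal P a b"
  have c[simp]: "of_int k = [:k:]" for k :: int by (simp add: of_int_poly)
  have f: "X ^ 3 + [:a:] * X - [:b:] = f"
    by (simp add: X_def f_def power3_eq_cube)
  have \<phi>: "[:u:] * X ^ 2 + [:v:] * X + [:w:] = \<phi>"
    by (simp add: X_def \<phi>_def power2_eq_square)
  have "f dvd X ^ p - \<phi>"
    using cubic_dvd_power_minus_useq[of X a b "p - 3"] p
    by (simp add: u_def v_def w_def Suc_diff_Suc numeral_3_eq_3 numeral_2_eq_2 f[symmetric] \<phi>[symmetric])
  then obtain K where K: "X ^ p - \<phi> = f * K" by blast
  have Xp: "coeff (X ^ p) p = 1" "degree (X ^ p) = p"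
    by (simp_all add: X_def degree_monom_eq flip: monom_altdef[of 1, simplified])
  \<comment> \<open>If \<open>\<phi>\<close> were X modulo P, then f(s) K(s) = s^p - s = 0 modulo P
    for every s. As f has no root, K would have p roots but degree p - 3, so P would divide K and
    hence the monic polynomial X^p - \<open>\<phi>\<close>.\<close>
  have nX: "\<not> (P dvd w \<and> P dvd v - 1 \<and> P dvd u)"
  proof
    assume triv: "P dvd w \<and> P dvd v - 1 \<and> P dvd u"
    have "degree \<phi> \<le> 2" by (simp add: \<phi>_def degree_pCons_le)
    then have dX: "degree (X ^ p - \<phi>) = p" "coeff (X ^ p - \<phi>) p = 1"
      using Xp p by (auto simp: coeff_eq_0 intro!: antisym degree_diff_le le_degree)
    have "f * K \<noteq> 0" using dX p by (metis K degree_0 not_less0)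
    then have "degree (f * K) = 3 + degree K" by (subst degree_mult_eq) (auto simp: f_def)
    then have "degree K < p" using dX K p by simp
    moreover have "P dvd poly K s" for s
    proof -
      have "poly f s * poly K s = s ^ p - (w + s * (v + s * u))"
        using arg_cong[OF K, of "\<lambda>q. poly q s"] by (simp add: X_def \<phi>_def)
      also have "\<dots> = (s ^ p - s) - (w + s * (v - 1) + s ^ 2 * u)" by (simp add: algebra_simps power2_eq_square power3_eq_cube)
      also have "P dvd \<dots>"
        using triv prime_dvd_power_diff_int[OF p(1), of s] unfolding P_def by (intro dvd_diff[of _ "s ^ p - s"] dvd_add) auto
      finally have "P dvd poly f s * poly K s" .
      moreover have "poly f s = s ^ 3 + a * s - b"
        by (simp add: f_def algebra_simps power3_eq_cube)
      ultimately show ?thesis using nr'[of s] prime_dvd_mult_iff[OF P(1)] by auto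
    qed
    moreover have "s = t" if "s \<in> {0..<P}" "t \<in> {0..<P}" "P dvd s - t" for s t
      using that by (metis atLeastLessThan_iff mod_eq_dvd_iff mod_pos_pos_trivial)
    ultimately have "[:P:] dvd K"
      by (intro prime_dvd_poly_if_many_roots[of P "{0..<P}"]) (use p in \<open>auto simp: P_def\<close>)
    then have "[:P:] dvd X ^ p - \<phi>" unfolding K by simp
    then have "P dvd 1" using dX by (metis const_poly_dvd_iff)
    then show False using P by auto
  qed
  have ff: "of_nat p dvd (x + y) ^ p - x ^ p - y ^ p" for x y :: "int poly"
    by (rule prime_dvd_freshman[OF p(1)])
  \<comment> \<open>f(X)^p = f(X^p) modulo P: the p-th power is additive, and Fermat fixes the
    coefficients a and - b.\<close>
  have "[:P:] dvd f ^ p - (X ^ (3 * p) + [:a:] * X ^ p - [:b:])"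
  proof -
    have pp: "of_nat p = [:P:]" by (simp add: P_def of_nat_poly)
    define A B where "A = [:a:]" and "B = [:- b:]"
    have 1: "[:P:] dvd (X ^ 3 + A * X + B) ^ p - (X ^ 3 + A * X) ^ p - B ^ p"
      using ff unfolding pp by blast
    have 2: "[:P:] dvd (X ^ 3 + A * X) ^ p - (X ^ 3) ^ p - (A * X) ^ p"
      using ff unfolding pp by blast
    have 3: "[:P:] dvd (A ^ p - A) * X ^ p"
      using prime_dvd_power_diff_int[OF p(1), of a]
      by (intro dvd_mult2) (simp add: P_def A_def poly_const_pow)
    have 4: "[:P:] dvd B ^ p - B"
      using prime_dvd_power_diff_int[OF p(1), of "- b"] by (simp add: P_def B_def poly_const_pow)
    have B: "B = - [:b:]" unfolding B_def by (metis minus_pCons minus_zero)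
    have f': "X ^ 3 + A * X + B = f"
      unfolding f[symmetric] A_def B by simp
    have "f ^ p - (X ^ (3 * p) + A * X ^ p + B)
       = ((X ^ 3 + A * X + B) ^ p - (X ^ 3 + A * X) ^ p - B ^ p)
        + ((X ^ 3 + A * X) ^ p - (X ^ 3) ^ p - (A * X) ^ p)
        + ((A ^ p - A) * X ^ p + (B ^ p - B))"
      unfolding f' power_mult power_mult_distrib by (simp add: algebra_simps)
    also have "[:P:] dvd \<dots>" by (intro dvd_add 1 2 3 4)
    finally show ?thesis unfolding A_def B add_uminus_conv_diff .
  qed
  then have "?I (f ^ p - (X ^ (3 * p) + [:a:] * X ^ p - [:b:]))"
    by (rule in_cubic_ideal_const)
  moreover have If: "?I (g * f)" for g
    unfolding f_def by (intro in_cubic_ideal_mult in_cubic_ideal_cubic)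
  moreover have "?I (f ^ p)" using If[of "f ^ (p - 1)"] p by (simp add: power_eq_if mult.commute)
  ultimately have "?I (f ^ p - (f ^ p - (X ^ (3 * p) + [:a:] * X ^ p - [:b:])))"
    using in_cubic_ideal_diff by blast
  moreover have diff_diff: "g - (g - h) = h" for g h :: "int poly" by simp
  ultimately have I1: "?I ((X ^ p) ^ 3 + [:a:] * X ^ p - [:b:])"
    by (simp only: mult.commute[of 3 p] power_mult)
  \<comment> \<open>Passage from f(X^p) to f(\<open>\<phi>\<close>): their difference is divisible
    by X^p - \<open>\<phi>\<close> = f K.\<close>
  define \<psi> where "\<psi> = X ^ p"
  have "\<psi> ^ 3 + [:a:] * \<psi> - [:b:] - (\<phi> ^ 3 + [:a:] * \<phi> - [:b:])
      = (\<psi>\<^sup>2 + \<psi> * \<phi> + \<phi>\<^sup>2 + [:a:]) * K * f"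
    using depressed_cubic_diff[of \<psi> \<phi> "[:a:]" "[:b:]"] K by (simp only: \<psi>_def ac_simps)
  then have "?I (\<psi> ^ 3 + [:a:] * \<psi> - [:b:] - (\<phi> ^ 3 + [:a:] * \<phi> - [:b:]))"
    by (simp only: If)
  from in_cubic_ideal_diff[OF I1[folded \<psi>_def] this] have I2: "?I (\<phi> ^ 3 + [:a:] * \<phi> - [:b:])"
    by (simp only: diff_diff)
  have "(\<phi> - X) * (\<phi> ^ 2 + \<phi> * X + X ^ 2 + [:a:]) = (\<phi> ^ 3 + [:a:] * \<phi> - [:b:]) - 1 * f"
    by (simp only: depressed_cubic_diff[of \<phi> X "[:a:]" "[:b:]"] f mult_1)
  then have "?I ((\<phi> - X) * (\<phi> ^ 2 + \<phi> * X + X ^ 2 + [:a:]))"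
    using in_cubic_ideal_diff[OF I2 If[of 1]] by (simp only:)
  moreover have "\<phi> - X = [:w, v - 1, u:]" by (simp add: \<phi>_def X_def)
  ultimately have "?I (\<phi> ^ 2 + \<phi> * X + X ^ 2 + [:a:])"
    using in_cubic_ideal_cancel[OF P(1) nr' nX] by (simp only:)
  \<comment> \<open>The multiplier of f is the quotient in the division of the quartic on the left
    by f; the remainder has degree at most 2.\<close>
  then have "?I ((\<phi> ^ 2 + \<phi> * X + X ^ 2 + [:a:]) - [:2 * u * v + u, u ^ 2:] * f)"
    using If in_cubic_ideal_diff by blast
  moreover have "(\<phi> ^ 2 + \<phi> * X + X ^ 2 + [:a:]) - [:2 * u * v + u, u ^ 2:] * f =
    [:2 * b * u * v + w ^ 2 + b * u + a, b * u ^ 2 - 2 * a * u * v + 2 * v * w + w - a * u,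
      - a * u ^ 2 + v ^ 2 + 2 * u * w + v + 1:]"
    by (simp add: \<phi>_def X_def f_def algebra_simps power2_eq_square)
  ultimately have "?I [:2 * b * u * v + w ^ 2 + b * u + a,
      b * u ^ 2 - 2 * a * u * v + 2 * v * w + w - a * u, - a * u ^ 2 + v ^ 2 + 2 * u * w + v + 1:]"
    by (simp only:)
  note E = in_cubic_ideal_remainder[OF this]
  show ?thesis
    using disc_if_no_root_aux[OF P _ nr' E(3) E(2) E(1)] a by (simp add: P_def u_def)
qed

section \<open>Arithmetic of p-adic numbers\<close>

lemma Zp_range:
  assumes "f \<in> Zp p" shows "0 \<le> f n" "f n < int p ^ n"
  using assms by (auto simp: Zp_def)

lemma Zp_mod:
  assumes "f \<in> Zp p" "n \<le> m" shows "f m mod int p ^ n = f n"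
  using assms(2)
proof (induction m rule: dec_induct)
  case base
  then show ?case using Zp_range[OF assms(1)] by simp
next
  case (step m)
  have "f (Suc m) mod int p ^ n = f (Suc m) mod int p ^ m mod int p ^ n"
    using step by (simp add: mod_mod_cancel le_imp_power_dvd)
  also have "\<dots> = f m mod int p ^ n" using assms(1) by (simp add: Zp_def)
  finally show ?case using step by simp
qed

lemma Zp_cong: "f \<in> Zp p \<Longrightarrow> n \<le> m \<Longrightarrow> [f m = f n] (mod int p ^ n)"
  by (simp add: cong_def Zp_mod Zp_mod[of f p n n])

lemma Zp_first_digit_dvd:
  assumes "f \<in> Zp p" shows "int p dvd f 1 \<longleftrightarrow> f 1 = 0"
  using Zp_range[OF assms, of 1] by (auto dest: zdvd_imp_le)

lemma ZpI:
  assumes "p > 0" "\<And>n. [g (Suc n) = g n] (mod int p ^ n)"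
  shows "(\<lambda>n. g n mod int p ^ n) \<in> Zp p"
  using assms by (auto simp: Zp_def cong_def mod_mod_cancel)

lemma Zp_cong_Suc: "f \<in> Zp p \<Longrightarrow> [f (Suc n) = f n] (mod int p ^ n)"
  by (rule Zp_cong) auto

lemma zmul_Zp: "p > 0 \<Longrightarrow> f \<in> Zp p \<Longrightarrow> g \<in> Zp p \<Longrightarrow> zmul p f g \<in> Zp p"
  unfolding zmul_def by (intro ZpI cong_mult Zp_cong_Suc) auto

lemma zadd_Zp: "p > 0 \<Longrightarrow> f \<in> Zp p \<Longrightarrow> g \<in> Zp p \<Longrightarrow> zadd p f g \<in> Zp p"
  unfolding zadd_def by (intro ZpI cong_add Zp_cong_Suc) auto

lemma zconst_Zp: "p > 0 \<Longrightarrow> zconst p c \<in> Zp p"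
  unfolding zconst_def by (intro ZpI) auto

lemma zmul_unit:
  assumes "prime p" "f \<in> Zp p" "g \<in> Zp p" "f 1 \<noteq> 0" "g 1 \<noteq> 0"
  shows "zmul p f g 1 \<noteq> 0"
proof -
  have "\<not> int p dvd f 1 * g 1"
    using assms Zp_first_digit_dvd prime_dvd_mult_iff[of "int p"] by auto
  then show ?thesis by (simp add: zmul_def dvd_eq_mod_eq_0)
qed

lemma qnorm_unit:
  assumes "s 1 \<noteq> 0" shows "qnorm p m s = (m, s)"
proof -
  have "zval s = 0" unfolding zval_def using assms by (intro Least_equality) auto
  moreover have "s \<noteq> zzero" using assms by (auto simp: zzero_def)
  ultimately show ?thesis by (simp add: qnorm_def zdivp_def)
qed

text \<open>This expresses t = p^(\<beta> - m) B by congruences at every precision, so that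
  arguments about roots need no normalisation. The nonzero first digit of B identifies \<beta> - m
  as the valuation of t.\<close>

lemma qnorm_eq_iff:
  assumes p: "p > 1" and t: "t \<in> Zp p" and B: "B \<in> Zp p" "B 1 \<noteq> 0"
  shows "qnorm p m t = (\<beta>, B) \<longleftrightarrow>
    m \<le> \<beta> \<and> (\<forall>n. [t n = int p ^ nat (\<beta> - m) * B n] (mod int p ^ n))"
proof
  assume q: "qnorm p m t = (\<beta>, B)"
  define v where "v = zval t"
  have "t \<noteq> zzero" using q B(2) by (auto simp: qnorm_def qzero_def zzero_def)
  then have \<beta>: "\<beta> = m + int v" and B': "B = zdivp p t v"
    using q by (auto simp: qnorm_def v_def)
  have "t v = 0"
  proof (cases v)
    case 0
    then show ?thesis using Zp_range[OF t, of 0] by simp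
  next
    case (Suc n)
    then have "n < (LEAST n. t (Suc n) \<noteq> 0)" unfolding v_def zval_def by simp
    then show ?thesis using not_less_Least Suc by blast
  qed
  then have dv: "int p ^ v dvd t (n + v)" for n
    using Zp_mod[OF t, of v "n + v"] by (simp add: dvd_eq_mod_eq_0)
  have "[t n = int p ^ v * B n] (mod int p ^ n)" for n
    using Zp_cong[OF t, of n "n + v"] dv[of n] by (simp add: B' zdivp_def cong_sym)
  then show "m \<le> \<beta> \<and> (\<forall>n. [t n = int p ^ nat (\<beta> - m) * B n] (mod int p ^ n))"
    by (simp add: \<beta>)
next
  assume A: "m \<le> \<beta> \<and> (\<forall>n. [t n = int p ^ nat (\<beta> - m) * B n] (mod int p ^ n))"
  define c where "c = nat (\<beta> - m)"
  have tn: "t n = (int p ^ c * B n) mod int p ^ n" for n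
    using A Zp_mod[OF t, of n n] by (simp add: c_def cong_def)
  \<comment> \<open>Division by p^c costs c digits of precision, hence the shift of the
    index.\<close>
  have tc: "t (n + c) = int p ^ c * B n" for n
  proof -
    have "t (n + c) = (int p ^ c * B (n + c)) mod (int p ^ c * int p ^ n)"
      unfolding tn[of "n + c"] by (simp add: power_add mult.commute)
    also have "\<dots> = int p ^ c * (B (n + c) mod int p ^ n)" by (rule mult_mod_right[symmetric])
    finally show ?thesis using Zp_mod[OF B(1), of n "n + c"] by simp
  qed
  have nz: "t (Suc c) \<noteq> 0" using tc[of 1] B(2) p by simp
  have "zval t = c"
    unfolding zval_def
  proof (rule Least_equality)
    show "t (Suc c) \<noteq> 0" by (rule nz)
    fix n assume n: "t (Suc n) \<noteq> 0"
    show "c \<le> n"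
    proof (rule ccontr)
      assume "\<not> c \<le> n"
      then have "int p ^ Suc n dvd int p ^ c * B (Suc n)" by (intro dvd_mult2 le_imp_power_dvd) simp
      then show False using n tn[of "Suc n"] by (simp add: dvd_eq_mod_eq_0)
    qed
  qed
  moreover have "zdivp p t c = B"
    using p tc by (auto simp: zdivp_def)
  moreover have "t \<noteq> zzero" using nz by (auto simp: zzero_def)
  moreover have "m + int c = \<beta>" using A by (simp add: c_def)
  ultimately show "qnorm p m t = (\<beta>, B)" by (simp add: qnorm_def)
qed

lemma qmul_unit:
  assumes "prime p" "f \<in> Zp p" "g \<in> Zp p" "f 1 \<noteq> 0" "g 1 \<noteq> 0"
  shows "qmul p (k, f) (l, g) = (k + l, zmul p f g)"
  using qnorm_unit[of "zmul p f g"] zmul_unit[OF assms] by (simp add: qmul_def)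

text \<open>\<open>m\<close> is the exponent to which \<open>qadd\<close> brings both summands.
  After division by p^m at least one of the two powers of p on the left is 1, and n = 1 gives the
  reduced equation modulo p.\<close>

lemma is_root_iff:
  assumes p: "prime p" and A: "A \<in> Zp p" "A 1 \<noteq> 0" and B: "B \<in> Zp p" "B 1 \<noteq> 0"
    and X: "X \<in> Zp p" "X 1 \<noteq> 0"
    and m: "m = min (3 * k) (\<alpha> + k)"
  shows "is_root p (\<alpha>, A) (\<beta>, B) (k, X) \<longleftrightarrow> m \<le> \<beta> \<and>
    (\<forall>n. [int p ^ nat (3 * k - m) * X n ^ 3 + int p ^ nat (\<alpha> + k - m) * A n * X n
      = int p ^ nat (\<beta> - m) * B n] (mod int p ^ n))"
proof -
  have p0: "p > 0" "p > 1" using p prime_gt_0_nat prime_gt_1_nat by blast+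
  define X3 where "X3 = zmul p X (zmul p X X)"
  define AX where "AX = zmul p A X"
  have X2: "zmul p X X \<in> Zp p" "zmul p X X 1 \<noteq> 0"
    using zmul_Zp zmul_unit p0 p X by blast+
  have X3: "X3 \<in> Zp p" "qmul p (k, X) (qmul p (k, X) (k, X)) = (3 * k, X3)"
    unfolding X3_def using zmul_Zp[OF p0(1) X(1) X2(1)]
    by (simp_all add: qmul_unit[OF p X(1) X(1) X(2) X(2)] qmul_unit[OF p X(1) X2(1) X(2) X2(2)])
  have AX: "AX \<in> Zp p" "qmul p (\<alpha>, A) (k, X) = (\<alpha> + k, AX)"
    unfolding AX_def using zmul_Zp[OF p0(1) A(1) X(1)] qmul_unit[OF p A(1) X(1) A(2) X(2)] by auto
  define t where "t = zadd p (zmul p (zconst p (int p ^ nat (3 * k - m))) X3)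
    (zmul p (zconst p (int p ^ nat (\<alpha> + k - m))) AX)"
  have t: "t \<in> Zp p" unfolding t_def by (intro zadd_Zp zmul_Zp zconst_Zp p0 X3 AX)
  have tn: "[t n = c] (mod int p ^ n) \<longleftrightarrow>
      [int p ^ nat (3 * k - m) * X n ^ 3 + int p ^ nat (\<alpha> + k - m) * A n * X n = c] (mod int p ^ n)" for n c
    unfolding t_def X3_def AX_def zadd_def zmul_def zconst_def cong_def
    by (simp add: mod_simps power3_eq_cube mult.assoc)
  have "is_root p (\<alpha>, A) (\<beta>, B) (k, X) \<longleftrightarrow> qnorm p m t = (\<beta>, B)"
    unfolding is_root_def X3 AX qadd_def by (simp add: m t_def Let_def)
  also have "\<dots> \<longleftrightarrow> m \<le> \<beta> \<and> (\<forall>n. [t n = int p ^ nat (\<beta> - m) * B n] (mod int p ^ n))"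
    by (rule qnorm_eq_iff[OF p0(2) t B])
  finally show ?thesis unfolding tn .
qed

section \<open>Hensel lifting and roots of a given valuation\<close>

text \<open>Newton's method. The coefficients are known only as compatible residues, so the
  polynomial itself varies with the precision. All approximations agree with \<open>y0\<close>
  modulo p, hence the derivative stays invertible.\<close>

lemma hensel_cubic:
  fixes p :: nat and C y0 :: int and A B :: "nat \<Rightarrow> int"
  assumes p: "prime p"
    and A: "\<And>m n. n \<le> m \<Longrightarrow> [A m = A n] (mod int p ^ n)"
    and B: "\<And>m n. n \<le> m \<Longrightarrow> [B m = B n] (mod int p ^ n)"
    and y0: "int p dvd C * y0 ^ 3 + A 1 * y0 - B 1"
    and d0: "\<not> int p dvd 3 * C * y0 ^ 2 + A 1"
  obtains X where "X \<in> Zp p" "[X 1 = y0] (mod int p)"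
    "\<And>n. [C * X n ^ 3 + A n * X n = B n] (mod int p ^ n)"
proof -
  define P where "P = int p"
  have P: "prime P" "P > 0" using p prime_gt_0_nat by (auto simp: P_def)
  define F where "F = (\<lambda>n y. C * y ^ 3 + A n * y - B n)"
  \<comment> \<open>\<open>good n\<close> concerns precision n + 1, so the iteration starts with
    \<open>y0\<close> modulo P rather than with the empty condition modulo 1.\<close>
  define good where "good = (\<lambda>n y. 0 \<le> y \<and> y < P ^ Suc n \<and> [y = y0] (mod P) \<and> P ^ Suc n dvd F (Suc n) y)"
  have F_cong: "[F m y = F n z] (mod P ^ n)" if "n \<le> m" "[y = z] (mod P ^ n)" for m n y z
    unfolding F_def using that A[OF that(1)] B[OF that(1)]
    by (auto simp: P_def intro!: cong_diff cong_add cong_mult cong_pow)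
  have base: "good 0 (y0 mod P)"
  proof -
    have "[F 1 (y0 mod P) = F 1 y0] (mod P ^ 1)" by (rule F_cong) auto
    then show ?thesis using y0 P by (auto simp: good_def F_def P_def cong_dvd_iff)
  qed
  have step: "\<exists>y'. good (Suc n) y' \<and> y' mod P ^ Suc n = y" if y: "good n y" for n y
  proof -
    define N where "N = Suc n"
    have gy: "0 \<le> y" "y < P ^ N" "[y = y0] (mod P)" "P ^ N dvd F N y"
      using y by (auto simp: good_def N_def)
    have "[F (Suc N) y = F N y] (mod P ^ N)" by (rule F_cong) auto
    then have "P ^ N dvd F (Suc N) y" using gy(4) cong_dvd_iff by blast
    then obtain q where q: "F (Suc N) y = P ^ N * q" by blast
    define d where "d = 3 * C * y ^ 2 + A (Suc N)"
    have "[d = 3 * C * y0 ^ 2 + A 1] (mod P)"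
      unfolding d_def using A[of 1 "Suc N"] gy(3)
      by (intro cong_add cong_mult cong_pow) (auto simp: P_def)
    then have "\<not> P dvd d" using d0 cong_dvd_iff unfolding P_def by blast
    then obtain i where i: "P dvd d * i - 1" using prime_int_inverse_mod[OF P(1)] by blast
    \<comment> \<open>By Taylor expansion F(y + P^N t) = P^N (q + t d) modulo P^(2 N). This t makes
      q + t d divisible by P, and 2 N >= N + 1.\<close>
    define t where "t = - (q * i)"
    define z where "z = y + P ^ N * t"
    have "F (Suc N) z = F (Suc N) y + P ^ N * t * d
        + P ^ N * P ^ N * (t ^ 2 * (3 * C * y + C * t * P ^ N))"
      unfolding F_def z_def d_def by (simp add: algebra_simps power2_eq_square power3_eq_cube)
    also have "\<dots> = P ^ N * (- q * (d * i - 1)) + P ^ N * P * (P ^ n * (t ^ 2 * (3 * C * y + C * t * P ^ N)))"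
      unfolding q t_def by (simp add: N_def algebra_simps)
    also have "P ^ N * P dvd \<dots>"
      by (intro dvd_add mult_dvd_mono[OF dvd_refl dvd_mult[OF i]] dvd_triv_left)
    finally have Fz: "P ^ Suc N dvd F (Suc N) z" by (simp add: mult.commute)
    define y' where "y' = z mod P ^ Suc N"
    have y'z: "[y' = z] (mod P ^ Suc N)" by (simp add: y'_def)
    then have "P ^ Suc N dvd F (Suc N) y'" using F_cong[OF order_refl] Fz cong_dvd_iff by blast
    moreover have y'N: "y' mod P ^ N = y"
      using gy(1,2) by (simp add: y'_def z_def mod_mod_cancel)
    moreover have "[y' = y0] (mod P)"
    proof -
      have "[y' = y] (mod P ^ N)" using y'N gy(1,2) by (simp add: cong_def)
      then have "[y' = y] (mod P)" by (rule cong_dvd_modulus) (simp add: N_def)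
      then show ?thesis using gy(3) cong_trans by blast
    qed
    moreover have "0 \<le> y'" "y' < P ^ Suc N" using P(2) by (simp_all add: y'_def)
    ultimately show ?thesis unfolding good_def N_def by blast
  qed
  obtain Y where Y: "\<And>n. good n (Y n)" "\<And>n. Y (Suc n) mod P ^ Suc n = Y n"
    using dependent_nat_choice[of good "\<lambda>n y y'. y' mod P ^ Suc n = y"] base step by metis
  \<comment> \<open>The index is shifted back; modulo p^0 the only residue is 0.\<close>
  define X where "X = (\<lambda>n. if n = 0 then 0 else Y (n - 1))"
  have "X \<in> Zp p"
  proof -
    have "0 \<le> X n \<and> X n < P ^ n \<and> X (Suc n) mod P ^ n = X n" for n
    proof (cases n)
      case 0
      then show ?thesis by (simp add: X_def)
    next
      case (Suc k)
      then show ?thesis using Y(1)[of k] Y(2)[of k] by (simp add: X_def good_def)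
    qed
    then show ?thesis by (simp add: Zp_def P_def)
  qed
  moreover have "[X 1 = y0] (mod int p)"
    using Y(1)[of 0] by (simp add: X_def good_def P_def)
  moreover have "[C * X n ^ 3 + A n * X n = B n] (mod int p ^ n)" for n
  proof (cases n)
    case (Suc k)
    then show ?thesis
      using Y(1)[of k] by (simp add: X_def good_def P_def F_def cong_iff_dvd_diff)
  qed simp
  ultimately show ?thesis using that by blast
qed

text \<open>\<open>c1\<close>, \<open>c2\<close>, \<open>c3\<close> are the exponents left after
  division by p^m, and \<open>c1 = 0 \<or> c2 = 0\<close> makes m the minimum required by
  \<open>is_root_iff\<close>. The simple nonzero root y of the residual congruence lifts to a
  unit.\<close>

lemma root_from_simple_residue:
  fixes p c1 c2 c3 :: nat and \<alpha> \<beta> k m y :: int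
  assumes p: "prime p" and A: "A \<in> Zp p" "A 1 \<noteq> 0" and B: "B \<in> Zp p" "B 1 \<noteq> 0"
    and c: "3 * k = m + int c1" "\<alpha> + k = m + int c2" "\<beta> = m + int c3" "c1 = 0 \<or> c2 = 0"
    and y: "int p dvd int p ^ c1 * y ^ 3 + int p ^ c2 * A 1 * y - int p ^ c3 * B 1"
    and y1: "\<not> int p dvd y" and d: "\<not> int p dvd 3 * int p ^ c1 * y ^ 2 + int p ^ c2 * A 1"
  shows "\<exists>X\<in>Zp p. X 1 \<noteq> 0 \<and> is_root p (\<alpha>, A) (\<beta>, B) (k, X)"
proof -
  have coh: "[e * D i = e * D j] (mod int p ^ j)" if "D \<in> Zp p" "j \<le> i" for D e i j
    using Zp_cong[OF that] by (rule cong_scalar_left)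
  obtain X where X: "X \<in> Zp p" "[X 1 = y] (mod int p)"
    "\<And>n. [int p ^ c1 * X n ^ 3 + int p ^ c2 * A n * X n = int p ^ c3 * B n] (mod int p ^ n)"
    using hensel_cubic[OF p coh[OF A(1)] coh[OF B(1)] y d] by blast
  have X1: "X 1 \<noteq> 0" using X(2) y1 by (metis cong_0_iff cong_sym)
  have m: "m = min (3 * k) (\<alpha> + k)" using c by auto
  have n: "nat (3 * k - m) = c1" "nat (\<alpha> + k - m) = c2" "nat (\<beta> - m) = c3" using c by auto
  have "is_root p (\<alpha>, A) (\<beta>, B) (k, X)"
    unfolding is_root_iff[OF p A B X(1) X1 m] n using X(3) c by simp
  then show ?thesis using X(1) X1 by blast
qed

text \<open>The disjuncts name the terms that survive division by the lowest power of p and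
  reduction modulo p: X^3 and B; X^3 and A X; A X and B; all three. Conversely each residual
  equation has a simple root, as 2 and 3 are invertible modulo p.\<close>

lemma root_with_valuation_iff:
  fixes p :: nat and \<alpha> \<beta> k :: int
  assumes p: "prime p" "p > 3" and A: "A \<in> Zp p" "A 1 \<noteq> 0" and B: "B \<in> Zp p" "B 1 \<noteq> 0"
  shows "(\<exists>X\<in>Zp p. X 1 \<noteq> 0 \<and> is_root p (\<alpha>, A) (\<beta>, B) (k, X)) \<longleftrightarrow>
      (3 * k = \<beta> \<and> \<beta> < \<alpha> + k \<and> (\<exists>y. [y ^ 3 = B 1] (mod int p)))
    \<or> (2 * k = \<alpha> \<and> 3 * k < \<beta> \<and> (\<exists>y. [y ^ 2 = - A 1] (mod int p)))
    \<or> (\<alpha> + k = \<beta> \<and> \<beta> < 3 * k)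
    \<or> (2 * k = \<alpha> \<and> 3 * k = \<beta> \<and> (\<exists>y. int p dvd y ^ 3 + A 1 * y - B 1))" (is "?L \<longleftrightarrow> ?R")
proof -
  define P where "P = int p"
  have P: "prime P" "P > 3" using p by (auto simp: P_def)
  have P3: "\<not> P dvd 3" "\<not> P dvd 2" using P by (auto dest!: zdvd_imp_le)
  have pm: "P dvd x * y \<longleftrightarrow> P dvd x \<or> P dvd y" for x y
    using P(1) by (rule prime_dvd_mult_iff)
  have pp: "P dvd x ^ n \<longleftrightarrow> P dvd x \<and> n > 0" for x n
    using prime_dvd_power_iff[OF P(1)] P(2) by (cases "n = 0") auto
  have nA: "\<not> P dvd A 1" and nB: "\<not> P dvd B 1"
    using Zp_first_digit_dvd A B by (auto simp: P_def)
  show ?thesis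
  proof
    assume ?L
    then obtain X where X: "X \<in> Zp p" "X 1 \<noteq> 0" and r: "is_root p (\<alpha>, A) (\<beta>, B) (k, X)" by blast
    define m where "m = min (3 * k) (\<alpha> + k)"
    define x where "x = X 1"
    have nx: "\<not> P dvd x" using Zp_first_digit_dvd X by (auto simp: P_def x_def)
    from r have m\<beta>: "m \<le> \<beta>" and
      "[int p ^ nat (3 * k - m) * X 1 ^ 3 + int p ^ nat (\<alpha> + k - m) * A 1 * X 1
      = int p ^ nat (\<beta> - m) * B 1] (mod int p ^ 1)"
      using is_root_iff[OF p(1) A B X m_def] by blast+
    then have e: "P dvd P ^ nat (3 * k - m) * x ^ 3 + P ^ nat (\<alpha> + k - m) * A 1 * x - P ^ nat (\<beta> - m) * B 1"
      by (simp add: P_def x_def cong_iff_dvd_diff)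
    have pos: "P dvd P ^ nat i \<longleftrightarrow> i > 0" for i using pp by simp
    consider "3 * k < \<alpha> + k" | "\<alpha> + k < 3 * k" | "3 * k = \<alpha> + k" by linarith
    then show ?R
    proof cases
      case 1
      then have m: "m = 3 * k" "\<alpha> + k - m > 0" by (auto simp: m_def)
      then have "P dvd P ^ nat (\<alpha> + k - m) * (A 1 * x)" using pos by simp
      then have "P dvd (P ^ nat (3 * k - m) * x ^ 3 + P ^ nat (\<alpha> + k - m) * A 1 * x - P ^ nat (\<beta> - m) * B 1)
          - P ^ nat (\<alpha> + k - m) * (A 1 * x)"
        by (rule dvd_diff[OF e])
      then have e1: "P dvd x ^ 3 - P ^ nat (\<beta> - m) * B 1" by (simp add: m mult.assoc)
      \<comment> \<open>Otherwise the right side vanishes modulo P, and with it the unit digit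
        x.\<close>
      have "\<beta> = m"
      proof (rule ccontr)
        assume "\<beta> \<noteq> m"
        then have "P dvd P ^ nat (\<beta> - m) * B 1" using m\<beta> pos by simp
        then have "P dvd x ^ 3" using e1 by (metis dvd_diff_left_iff)
        then show False using nx pp by simp
      qed
      then show ?thesis using e1 1 m by (auto simp: P_def cong_iff_dvd_diff)
    next
      case 2
      then have m: "m = \<alpha> + k" "3 * k - m > 0" by (auto simp: m_def)
      then have "P dvd P ^ nat (3 * k - m) * x ^ 3" using pos by simp
      then have "P dvd (P ^ nat (3 * k - m) * x ^ 3 + P ^ nat (\<alpha> + k - m) * A 1 * x - P ^ nat (\<beta> - m) * B 1)
          - P ^ nat (3 * k - m) * x ^ 3"
        by (rule dvd_diff[OF e])
      then have e1: "P dvd A 1 * x - P ^ nat (\<beta> - m) * B 1" by (simp add: m)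
      have "\<beta> = m"
      proof (rule ccontr)
        assume "\<beta> \<noteq> m"
        then have "P dvd P ^ nat (\<beta> - m) * B 1" using m\<beta> pos by simp
        then have "P dvd A 1 * x" using e1 by (metis dvd_diff_left_iff)
        then show False using nx nA pm by simp
      qed
      then show ?thesis using 2 m by auto
    next
      case 3
      then have m: "m = 3 * k" "m = \<alpha> + k" by (auto simp: m_def)
      have e1: "P dvd x ^ 3 + A 1 * x - P ^ nat (\<beta> - m) * B 1" using e by (simp flip: m)
      show ?thesis
      proof (cases "\<beta> = m")
        case True
        then have "P dvd x ^ 3 + A 1 * x - B 1" using e1 by simp
        then show ?thesis using True 3 m unfolding P_def by auto
      next
        case False
        then have "P dvd P ^ nat (\<beta> - m) * B 1" using m\<beta> pos by simp
        \<comment> \<open>The right side vanishes modulo P; cancelling the unit x leaves x^2 = -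
          A.\<close>
        then have "P dvd x ^ 3 + A 1 * x" using e1 by (metis dvd_diff_left_iff)
        also have "x ^ 3 + A 1 * x = x * (x ^ 2 - (- A 1))"
          by (simp add: algebra_simps power2_eq_square power3_eq_cube)
        finally have "[x ^ 2 = - A 1] (mod int p)" using nx pm by (simp add: P_def cong_iff_dvd_diff)
        then show ?thesis using False m\<beta> 3 m by auto
      qed
    qed
  next
    note lift = root_from_simple_residue[OF p(1) A B, folded P_def]
    assume ?R
    then consider
      (1) y where "3 * k = \<beta>" "\<beta> < \<alpha> + k" "P dvd y ^ 3 - B 1"
    | (2) y where "2 * k = \<alpha>" "3 * k < \<beta>" "P dvd y ^ 2 + A 1"
    | (3) "\<alpha> + k = \<beta>" "\<beta> < 3 * k"
    | (4) y where "2 * k = \<alpha>" "3 * k = \<beta>" "P dvd y ^ 3 + A 1 * y - B 1"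
      by (auto simp: P_def cong_iff_dvd_diff)
    then show ?L
    proof cases
      case 1
      have ny: "\<not> P dvd y"
      proof
        assume "P dvd y"
        then have "P dvd y ^ 3" using pp by simp
        then show False using 1(3) nB by (metis dvd_diff_right_iff)
      qed
      define c2 where "c2 = nat (\<alpha> + k - \<beta>)"
      have c2: "P dvd P ^ c2 * z" for z using 1 pp by (simp add: c2_def)
      have "P dvd P ^ 0 * y ^ 3 + P ^ c2 * A 1 * y - P ^ 0 * B 1"
        using dvd_add[OF 1(3) c2[of "A 1 * y"]] by (simp add: algebra_simps)
      moreover have "\<not> P dvd 3 * P ^ 0 * y ^ 2 + P ^ c2 * A 1"
      proof
        assume "P dvd 3 * P ^ 0 * y ^ 2 + P ^ c2 * A 1"
        then have "P dvd 3 * y ^ 2" using c2 by (metis dvd_add_left_iff mult_1_right power_0)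
        then show False using pm pp P3 ny by simp
      qed
      ultimately show ?thesis
        using 1 ny by (intro lift[of k \<beta> 0 \<alpha> c2 \<beta> 0 y]) (auto simp: c2_def)
    next
      case 2
      have ny: "\<not> P dvd y"
      proof
        assume "P dvd y"
        then have "P dvd y ^ 2" using pp by simp
        then show False using 2(3) nA by (metis dvd_add_right_iff)
      qed
      define c3 where "c3 = nat (\<beta> - 3 * k)"
      have c3: "P dvd P ^ c3 * z" for z using 2 pp by (simp add: c3_def)
      have "P dvd P ^ 0 * y ^ 3 + P ^ 0 * A 1 * y - P ^ c3 * B 1"
        using dvd_diff[OF dvd_mult[OF 2(3), of y] c3[of "B 1"]]
        by (simp add: algebra_simps power2_eq_square power3_eq_cube)
      \<comment> \<open>Since y^2 = - A modulo P, the derivative 3 y^2 + A equals 2 y^2.\<close>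
      moreover have "\<not> P dvd 3 * P ^ 0 * y ^ 2 + P ^ 0 * A 1"
      proof
        assume "P dvd 3 * P ^ 0 * y ^ 2 + P ^ 0 * A 1"
        then have "P dvd (3 * P ^ 0 * y ^ 2 + P ^ 0 * A 1) - (y ^ 2 + A 1)" using 2(3) by (rule dvd_diff)
        then have "P dvd 2 * y ^ 2" by simp
        then show False using pm pp P3 ny by simp
      qed
      ultimately show ?thesis
        using 2 ny by (intro lift[of k "3 * k" 0 \<alpha> 0 \<beta> c3 y]) (auto simp: c3_def)
    next
      case 3
      obtain i where i: "P dvd A 1 * i - 1" using prime_int_inverse_mod[OF P(1) nA] .
      define y where "y = i * B 1"
      have "A 1 * y - B 1 = (A 1 * i - 1) * B 1" by (simp add: y_def algebra_simps)
      then have y: "P dvd A 1 * y - B 1" using i by simp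
      then have ny: "\<not> P dvd y" using nB by (metis dvd_diff_right_iff dvd_mult)
      define c1 where "c1 = nat (3 * k - \<beta>)"
      have c1: "P dvd P ^ c1 * z" for z using 3 pp by (simp add: c1_def)
      have "P dvd P ^ c1 * y ^ 3 + P ^ 0 * A 1 * y - P ^ 0 * B 1"
        using dvd_add[OF c1[of "y ^ 3"] y] by (simp add: algebra_simps)
      moreover have "\<not> P dvd 3 * P ^ c1 * y ^ 2 + P ^ 0 * A 1"
      proof
        assume "P dvd 3 * P ^ c1 * y ^ 2 + P ^ 0 * A 1"
        then have "P dvd (3 * P ^ c1 * y ^ 2 + P ^ 0 * A 1) - P ^ c1 * (3 * y ^ 2)"
          using c1 by (rule dvd_diff)
        then show False using nA by (simp add: algebra_simps)
      qed
      ultimately show ?thesis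
        using 3 ny by (intro lift[of k \<beta> c1 \<alpha> 0 \<beta> 0 y]) (auto simp: c1_def)
    next
      case 4
      \<comment> \<open>a double root \<open>y\<close> is accompanied by the simple root \<open>- 2 y\<close>\<close>
      have ny: "\<not> P dvd z" if "P dvd z ^ 3 + A 1 * z - B 1" for z
      proof
        assume "P dvd z"
        then have "P dvd z ^ 3 + A 1 * z" using pp by simp
        then show False using that nB by (metis dvd_diff_right_iff)
      qed
      have "\<exists>z. P dvd z ^ 3 + A 1 * z - B 1 \<and> \<not> P dvd 3 * z ^ 2 + A 1"
      proof (cases "P dvd 3 * y ^ 2 + A 1")
        case True
        have "(- 2 * y) ^ 3 + A 1 * (- 2 * y) - B 1
            = (y ^ 3 + A 1 * y - B 1) - 3 * y * (3 * y ^ 2 + A 1)"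
          by (simp add: algebra_simps power2_eq_square power3_eq_cube)
        then have "P dvd (- 2 * y) ^ 3 + A 1 * (- 2 * y) - B 1"
          using dvd_diff[OF 4(3) dvd_mult[OF True]] by metis
        moreover have "\<not> P dvd 3 * (- 2 * y) ^ 2 + A 1"
        proof
          assume "P dvd 3 * (- 2 * y) ^ 2 + A 1"
          then have "P dvd (3 * (- 2 * y) ^ 2 + A 1) - (3 * y ^ 2 + A 1)" using True by (rule dvd_diff)
          then have "P dvd 3 * (3 * (y * y))" by (simp add: power2_eq_square)
          then show False using pm P3 ny[OF 4(3)] by blast
        qed
        ultimately show ?thesis by blast
      qed (use 4(3) in blast)
      then obtain z where z: "P dvd z ^ 3 + A 1 * z - B 1" "\<not> P dvd 3 * z ^ 2 + A 1" by blast
      then show ?thesis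
        using 4 ny[OF z(1)] by (intro lift[of k \<beta> 0 \<alpha> 0 \<beta> 0 z]) auto
    qed
  qed
qed

section \<open>The solvability criterion\<close>

lemma disc_cond_iff:
  assumes "prime p" "p > 3" "A \<in> Zp p" "A 1 \<noteq> 0"
  shows "disc_cond p (\<alpha>, A) (\<beta>, B) \<longleftrightarrow> (\<exists>y. int p dvd y ^ 3 + A 1 * y - B 1)"
proof -
  have "\<not> int p dvd A 1" using assms Zp_first_digit_dvd by blast
  then show ?thesis
    using useq_disc_if_root[of p "A 1" _ "B 1"] disc_if_no_root[of p "A 1" "B 1"] assms
    unfolding disc_cond_def digit0_def cong_iff_dvd_diff snd_conv by blast
qed

lemma cbrt_exists_iff:
  assumes "prime p" "B \<in> Zp p" "B 1 \<noteq> 0"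
  shows "cbrt_exists p (\<beta>, B) \<longleftrightarrow> (\<exists>y. [y ^ 3 = B 1] (mod int p)) \<and> 3 dvd \<beta>"
  using assms power_residue_criterion[of p 3 "B 1"] Zp_first_digit_dvd[of B p]
  by (simp add: cbrt_exists_def digit0_def logabs_def)

lemma sqrt_exists_qneg_iff:
  assumes "prime p" "p > 3" "A \<in> Zp p" "A 1 \<noteq> 0"
  shows "sqrt_exists p (qneg p (\<alpha>, A)) \<longleftrightarrow> (\<exists>y. [y ^ 2 = - A 1] (mod int p)) \<and> even \<alpha>"
proof -
  have "odd p" using assms prime_odd_nat by force
  then have "gcd 2 (p - 1) = 2" by (intro gcd_nat.absorb1) simp
  then have *: "(\<exists>y. [y ^ 2 = - A 1] (mod int p)) \<longleftrightarrow> [(- A 1) ^ ((p - 1) div 2) = 1] (mod int p)"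
    using assms power_residue_criterion[of p 2 "- A 1"] Zp_first_digit_dvd[of A p] by simp
  have "[((- A 1) mod int p) ^ n = 1] (mod int p) \<longleftrightarrow> [(- A 1) ^ n = 1] (mod int p)" for n
    by (simp add: cong_def power_mod)
  then show ?thesis
    unfolding * by (simp add: sqrt_exists_def digit0_def logabs_def qneg_def zneg_def)
qed

section \<open>From absolute values to valuations\<close>

lemma qabs_unit: "u 1 \<noteq> 0 \<Longrightarrow> qabs p (k, u) = real p powi (- k)"
  by (auto simp: qabs_def zzero_def)

lemma zero_not_root:
  assumes "b \<noteq> qzero" shows "\<not> is_root p a b qzero"
proof -
  have [simp]: "zmul p u zzero = zzero" "zmul p zzero u = zzero" for u
    by (simp_all add: zmul_def zzero_def)
  have [simp]: "zadd p zzero zzero = zzero" by (simp add: zadd_def zzero_def)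
  show ?thesis
    using assms by (auto simp: is_root_def qmul_def qadd_def qnorm_def qzero_def Let_def)
qed

text \<open>As b is nonzero, zero is no root. The remaining canonical pairs have a unit component,
  and for them membership in each of the three sets of the theorem depends on the valuation k
  alone.\<close>

lemma solvable_in_iff_valuation:
  assumes b: "b \<noteq> qzero"
    and S: "\<And>k u. u \<in> Zp p \<Longrightarrow> u 1 \<noteq> 0 \<Longrightarrow> (k, u) \<in> S \<longleftrightarrow> k \<in> V"
  shows "solvable_in p a b S \<longleftrightarrow> (\<exists>k\<in>V. \<exists>u\<in>Zp p. u 1 \<noteq> 0 \<and> is_root p a b (k, u))"
proof
  assume "solvable_in p a b S"
  then obtain k u where x: "(k, u) \<in> Qp p" "(k, u) \<in> S" "is_root p a b (k, u)"
    unfolding solvable_in_def by (metis surj_pair)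
  have "(k, u) \<noteq> qzero" using zero_not_root[OF b] x(3) by metis
  then have "u \<in> Zp p" "u 1 \<noteq> 0" using x(1) by (auto simp: Qp_def qzero_def)
  then show "\<exists>k\<in>V. \<exists>u\<in>Zp p. u 1 \<noteq> 0 \<and> is_root p a b (k, u)" using x S by blast
next
  assume "\<exists>k\<in>V. \<exists>u\<in>Zp p. u 1 \<noteq> 0 \<and> is_root p a b (k, u)"
  then show "solvable_in p a b S"
    unfolding solvable_in_def using S by (fastforce simp: Qp_def)
qed

theorem mainTheorem5:
  fixes p :: nat and a b :: "int \<times> (nat \<Rightarrow> int)"
  assumes "prime p" and "p > 3"
    and "a \<in> Qp p" and "b \<in> Qp p" and "a \<noteq> qzero" and "b \<noteq> qzero"
  shows
   "(solvable_in p a b (Zp_units p) \<longleftrightarrow>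
      (qabs p a < qabs p b \<and> qabs p b = 1 \<and> cbrt_exists p b)
    \<or> (qabs p b < qabs p a \<and> qabs p a = 1 \<and> sqrt_exists p (qneg p a))
    \<or> (qabs p a = 1 \<and> qabs p b = 1 \<and> disc_cond p a b)
    \<or> (qabs p a = qabs p b \<and> qabs p b > 1))
  \<and> (solvable_in p a b (Zp_num p - Zp_units p) \<longleftrightarrow>
      (qabs p a ^ 3 < qabs p b ^ 2 \<and> qabs p b ^ 2 < 1 \<and> cbrt_exists p b)
    \<or> (qabs p a ^ 3 = qabs p b ^ 2 \<and> qabs p b ^ 2 < 1 \<and> disc_cond p a b)
    \<or> (qabs p a ^ 3 > qabs p b ^ 2 \<and> qabs p a > qabs p b))
  \<and> (solvable_in p a b (Qp p - Zp_num p) \<longleftrightarrow>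
      (qabs p a ^ 3 < qabs p b ^ 2 \<and> qabs p b > 1 \<and> cbrt_exists p b)
    \<or> (qabs p a ^ 3 = qabs p b ^ 2 \<and> qabs p b ^ 2 > 1 \<and> disc_cond p a b)
    \<or> (qabs p a ^ 3 > qabs p b ^ 2 \<and>
        (qabs p a < qabs p b \<or>
         (qabs p a \<ge> qabs p b \<and> qabs p a > 1 \<and> sqrt_exists p (qneg p a)))))"
proof -
  note p = assms(1,2)
  obtain \<alpha> A where a: "a = (\<alpha>, A)" by (metis surj_pair)
  obtain \<beta> B where b: "b = (\<beta>, B)" by (metis surj_pair)
  have A: "A \<in> Zp p" "A 1 \<noteq> 0" using assms(3,5) by (auto simp: a Qp_def qzero_def)
  have B: "B \<in> Zp p" "B 1 \<noteq> 0" using assms(4,6) by (auto simp: b Qp_def qzero_def)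
  have p1: "real p > 1" using p by simp
  have less: "real p powi i < real p powi j \<longleftrightarrow> i < j" for i j
    using power_int_strict_increasing[OF _ p1] by (metis linorder_less_linear less_asym')
  have le: "real p powi i \<le> real p powi j \<longleftrightarrow> i \<le> j" for i j
    using less[of j i] by linarith
  have eq: "real p powi i = real p powi j \<longleftrightarrow> i = j" for i j
    using less[of i j] less[of j i] by (metis linorder_less_linear less_irrefl)
  have one: "1 = real p powi 0" by simp
  have qa: "qabs p a = real p powi (- \<alpha>)" and qb: "qabs p b = real p powi (- \<beta>)"
    using A B by (simp_all add: a b qabs_unit)
  have qa3: "qabs p a ^ 3 = real p powi (- 3 * \<alpha>)" and qb2: "qabs p b ^ 2 = real p powi (- 2 * \<beta>)"
    unfolding qa qb by (simp_all add: power_int_power' mult.commute)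
  \<comment> \<open>Norms are powers of p with negated valuation, so comparisons reverse and become
    linear conditions on \<alpha> and \<beta>.\<close>
  have cmp: "qabs p a < qabs p b \<longleftrightarrow> \<beta> < \<alpha>" "qabs p b < qabs p a \<longleftrightarrow> \<alpha> < \<beta>"
    "qabs p a = qabs p b \<longleftrightarrow> \<alpha> = \<beta>" "qabs p b \<le> qabs p a \<longleftrightarrow> \<alpha> \<le> \<beta>"
    "qabs p a = 1 \<longleftrightarrow> \<alpha> = 0" "qabs p b = 1 \<longleftrightarrow> \<beta> = 0"
    "1 < qabs p a \<longleftrightarrow> \<alpha> < 0" "1 < qabs p b \<longleftrightarrow> \<beta> < 0"
    "qabs p a ^ 3 < qabs p b ^ 2 \<longleftrightarrow> 2 * \<beta> < 3 * \<alpha>"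
    "qabs p b ^ 2 < qabs p a ^ 3 \<longleftrightarrow> 3 * \<alpha> < 2 * \<beta>"
    "qabs p a ^ 3 = qabs p b ^ 2 \<longleftrightarrow> 3 * \<alpha> = 2 * \<beta>"
    "qabs p b ^ 2 < 1 \<longleftrightarrow> 0 < \<beta>" "1 < qabs p b ^ 2 \<longleftrightarrow> \<beta> < 0"
    unfolding qa3 qb2 unfolding qa qb one less le eq by linarith+
  have qx: "qabs p (k, u) \<le> 1 \<longleftrightarrow> k \<ge> 0" "qabs p (k, u) = 1 \<longleftrightarrow> k = 0" if "u 1 \<noteq> 0" for k u
    unfolding qabs_unit[of u p k, OF that] one le eq by auto
  define cb where "cb = (\<exists>y. [y ^ 3 = B 1] (mod int p))"
  define sq where "sq = (\<exists>y. [y ^ 2 = - A 1] (mod int p))"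
  define dc where "dc = (\<exists>y. int p dvd y ^ 3 + A 1 * y - B 1)"
  have conds: "cbrt_exists p b \<longleftrightarrow> cb \<and> 3 dvd \<beta>" "sqrt_exists p (qneg p a) \<longleftrightarrow> sq \<and> even \<alpha>"
    "disc_cond p a b \<longleftrightarrow> dc"
    unfolding a b cb_def sq_def dc_def
    by (rule cbrt_exists_iff[OF p(1) B] sqrt_exists_qneg_iff[OF p A] disc_cond_iff[OF p A])+
  define R where "R = (\<lambda>k. (3 * k = \<beta> \<and> \<beta> < \<alpha> + k \<and> cb) \<or> (2 * k = \<alpha> \<and> 3 * k < \<beta> \<and> sq)
    \<or> (\<alpha> + k = \<beta> \<and> \<beta> < 3 * k) \<or> (2 * k = \<alpha> \<and> 3 * k = \<beta> \<and> dc))"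
  have root: "(\<exists>u\<in>Zp p. u 1 \<noteq> 0 \<and> is_root p a b (k, u)) \<longleftrightarrow> R k" for k
    unfolding a b R_def cb_def sq_def dc_def by (rule root_with_valuation_iff[OF p A B])
  have I: "solvable_in p a b (Zp_units p) \<longleftrightarrow> (\<exists>k\<in>{0}. R k)"
    unfolding root[symmetric]
    by (rule solvable_in_iff_valuation[OF assms(6)]) (simp add: Zp_units_def Qp_def qx)
  have II: "solvable_in p a b (Zp_num p - Zp_units p) \<longleftrightarrow> (\<exists>k\<in>{0<..}. R k)"
    unfolding root[symmetric]
    by (rule solvable_in_iff_valuation[OF assms(6)]) (auto simp: Zp_units_def Zp_num_def Qp_def qx)
  have III: "solvable_in p a b (Qp p - Zp_num p) \<longleftrightarrow> (\<exists>k\<in>{..<0}. R k)"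
    unfolding root[symmetric]
    by (rule solvable_in_iff_valuation[OF assms(6)]) (auto simp: Zp_num_def Qp_def qx)
  have "(\<exists>k\<in>{0}. R k) \<longleftrightarrow> (\<beta> < \<alpha> \<and> \<beta> = 0 \<and> cb \<and> 3 dvd \<beta>) \<or> (\<alpha> < \<beta> \<and> \<alpha> = 0 \<and> sq \<and> even \<alpha>)
      \<or> (\<alpha> = 0 \<and> \<beta> = 0 \<and> dc) \<or> (\<alpha> = \<beta> \<and> \<beta> < 0)"
    unfolding R_def by auto
  moreover have "(\<exists>k\<in>{0<..}. R k) \<longleftrightarrow> (2 * \<beta> < 3 * \<alpha> \<and> 0 < \<beta> \<and> cb \<and> 3 dvd \<beta>)
      \<or> (3 * \<alpha> = 2 * \<beta> \<and> 0 < \<beta> \<and> dc) \<or> (3 * \<alpha> < 2 * \<beta> \<and> \<alpha> < \<beta>)"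
    (is "?L \<longleftrightarrow> ?R")
  proof
    \<comment> \<open>A root with k = \<alpha> / 2 > 0 and 3 k < \<beta> has 3 \<alpha> < 2 \<beta>
      and \<alpha> < \<beta>, so it falls under the last alternative. There a root of valuation
      \<beta> - \<alpha> exists in any case, which is why no square root condition appears.\<close>
    show "?L \<Longrightarrow> ?R" unfolding R_def by auto
    assume ?R
    then consider j where "\<beta> = 3 * j" "2 * \<beta> < 3 * \<alpha>" "0 < \<beta>" cb
      | "3 * \<alpha> = 2 * \<beta>" "0 < \<beta>" dc | "3 * \<alpha> < 2 * \<beta>" "\<alpha> < \<beta>"
      by (auto elim: dvdE)
    then show ?L
    proof cases
      case 1
      then show ?thesis unfolding R_def by (intro bexI[of _ j]) auto
    \<comment> \<open>The valuation \<beta> - \<alpha> serves both remaining cases: it balances A X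
      against B if 3 \<alpha> < 2 \<beta>, and equals \<alpha> / 2 = \<beta> / 3 if 3 \<alpha> = 2
      \<beta>.\<close>
    qed (auto simp: R_def intro!: bexI[of _ "\<beta> - \<alpha>"])
  qed
  moreover have "(\<exists>k\<in>{..<0}. R k) \<longleftrightarrow> (2 * \<beta> < 3 * \<alpha> \<and> \<beta> < 0 \<and> cb \<and> 3 dvd \<beta>)
      \<or> (3 * \<alpha> = 2 * \<beta> \<and> \<beta> < 0 \<and> dc)
      \<or> (3 * \<alpha> < 2 * \<beta> \<and> (\<beta> < \<alpha> \<or> (\<alpha> \<le> \<beta> \<and> \<alpha> < 0 \<and> sq \<and> even \<alpha>)))"
    (is "?L \<longleftrightarrow> ?R")
  proof
    show "?L \<Longrightarrow> ?R" unfolding R_def by auto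
    assume ?R
    then consider j where "\<beta> = 3 * j" "2 * \<beta> < 3 * \<alpha>" "\<beta> < 0" cb
      | "3 * \<alpha> = 2 * \<beta>" "\<beta> < 0" dc | "3 * \<alpha> < 2 * \<beta>" "\<beta> < \<alpha>"
      | j where "\<alpha> = 2 * j" "3 * \<alpha> < 2 * \<beta>" "\<alpha> < 0" sq
      by (auto elim: dvdE)
    then show ?L
    proof cases
      case 1
      then show ?thesis unfolding R_def by (intro bexI[of _ j]) auto
    next
      \<comment> \<open>Here k = \<alpha> / 2 is negative. If \<alpha> \<le> \<beta>, the other
        candidate \<beta> - \<alpha> is not, so the square root is indispensable.\<close>
      case 4
      then show ?thesis unfolding R_def by (intro bexI[of _ j]) auto
    qed (auto simp: R_def intro!: bexI[of _ "\<beta> - \<alpha>"])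
  qed
  ultimately show ?thesis
    unfolding I II III conds cmp by (intro conjI)
qed

end
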